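(* Let $R$ be a unital commutative ring, $(\mathcal B,\mathcal L,\theta,\mathcal I,\mathcal J)$ a relative generalized Boolean dynamical system and $\mathcal A$ a $\mathbb Z$-graded $R$-algebra. If $f:L_R(\mathcal B,\mathcal L,\theta,\mathcal I,\mathcal J)\to\mathcal A$ is a $\mathbb Z$-graded homomorphism of $R$-algebras, then $f$ is injective if and only if, for all $0\neq r\in R$, $f(rp_A)\neq0$ for all $\emptyset\neq A\in\mathcal B$ and $f(rq_A)\neq0$ for all $A\in\mathcal B_{\mathrm{reg}}\setminus\mathcal J$.
   Context: A generalized Boolean algebra $\mathcal B$ is a distributive lattice with relative complements and a least element $\emptyset$; write $\cup,\cap,\setminus,\subseteq$ for join, meet, relative complement and order. Morphisms preserve $\emptyset$ and all operations. An ideal is a nonempty subset closed under $\cup$ and under $\cap$ with arbitrary elements of $\mathcal B$. A relative generalized Boolean dynamical system $(\mathcal B,\mathcal L,\theta,\mathcal I,\mathcal J)$ consists of a generalized Boolean algebra $\mathcal B$, a set $\mathcal L$, morphisms $\theta_\alpha:\mathcal B\to\mathcal B$ ($\alpha\in\mathcal L$), ideals $\mathcal I_\alpha$ ($\alpha\in\mathcal L$) with $\{A\in\mathcal B:A\subseteq\theta_\alpha(B)\text{ for some }B\in\mathcal B\}\subseteq\mathcal I_\alpha$, and an ideal $\mathcal J$ of $\mathcal B$ contained in $\mathcal B_{\mathrm{reg}}$, where $\Delta_A=\{\alpha\in\mathcal L:\theta_\alpha(A)\neq\emptyset\}$ and $\mathcal B_{\mathrm{reg}}=\{A\in\mathcal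 B:0<|\Delta_B|<\infty\text{ for all }\emptyset\neq B\subseteq A\}$. $L_R(\mathcal B,\mathcal L,\theta,\mathcal I,\mathcal J)$ is the universal associative (not necessarily unital) $R$-algebra generated by $\{p_A\}_{A\in\mathcal B}\cup\{s_{\alpha,B},s_{\alpha,B}^*\}_{\alpha\in\mathcal L,B\in\mathcal I_\alpha}$ subject to: (1) $p_\emptyset=0$, $p_{A\cap A'}=p_Ap_{A'}$, $p_{A\cup A'}=p_A+p_{A'}-p_{A\cap A'}$; (2) $p_As_{\alpha,B}=s_{\alpha,B}p_{\theta_\alpha(A)}$ and $s_{\alpha,B}^*p_A=p_{\theta_\alpha(A)}s_{\alpha,B}^*$; (3) $s_{\alpha,B}^*s_{\alpha',B'}=\delta_{\alpha,\alpha'}p_{B\cap B'}$; (4) $s_{\alpha,B}p_{B'}=s_{\alpha,B\cap B'}$ and $p_{B'}s_{\alpha,B}^*=s_{\alpha,B\cap B'}^*$; (5) $p_A=\sum_{\alpha\in\Delta_A}s_{\alpha,\theta_\alpha(A)}s_{\alpha,\theta_\alpha(A)}^*$ for all $A\in\mathcal J$. It is $\mathbb Z$-graded with $\deg p_A=0$, $\deg s_{\alpha,A}=1$, $\deg s_{\alpha,A}^*=-1$. A homomorphism of $\mathbb Z$-graded algebras is graded if it maps degree $n$ to degree $n$ for all $n\in\mathbb Z$. For $|\Delta_A|<\infty$, $q_A:=p_A-\sum_{\alpha\in\Delta_A}s_{\alpha,\theta_\alpha(A)}s_{\alpha,\theta_\alpha(A)}^*$. *)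

theory Defs
  imports Complex_Main "HOL-Library.Poly_Mapping"
begin

section \<open>Generalized Boolean dynamical systems\<close>

class generalized_boolean_algebra = distrib_lattice + order_bot + minus +
  assumes inf_relcomp: "inf y (x - y) = bot"
    and sup_relcomp: "sup (inf x y) (x - y) = x"

definition gba_morphism :: "('b::generalized_boolean_algebra \<Rightarrow> 'b) \<Rightarrow> bool" where
  "gba_morphism h \<longleftrightarrow> h bot = bot \<and>
     (\<forall>A B. h (sup A B) = sup (h A) (h B) \<and> h (inf A B) = inf (h A) (h B) \<and> h (A - B) = h A - h B)"

definition gba_ideal :: "'b::generalized_boolean_algebra set \<Rightarrow> bool" where
  "gba_ideal K \<longleftrightarrow> K \<noteq> {} \<and> (\<forall>A\<in>K. \<forall>B\<in>K. sup A B \<in> K) \<and> (\<forall>A\<in>K. \<forall>B. inf A B \<in> K)"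

definition Delta :: "'l set \<Rightarrow> ('l \<Rightarrow> 'b::generalized_boolean_algebra \<Rightarrow> 'b) \<Rightarrow> 'b \<Rightarrow> 'l set" where
  "Delta L \<theta> A = {\<alpha> \<in> L. \<theta> \<alpha> A \<noteq> bot}"

definition regular :: "'l set \<Rightarrow> ('l \<Rightarrow> 'b::generalized_boolean_algebra \<Rightarrow> 'b) \<Rightarrow> 'b set" where
  "regular L \<theta> = {A. \<forall>B. B \<noteq> bot \<and> B \<le> A \<longrightarrow> Delta L \<theta> B \<noteq> {} \<and> finite (Delta L \<theta> B)}"

text \<open>The label set is a set \<open>L\<close> rather than a type, since it may be empty. The values of
  \<open>\<theta>\<close> and \<open>\<I>\<close> outside \<open>L\<close> are irrelevant.\<close>

locale relative_gbds =
  fixes L :: "'l set"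
    and \<theta> :: "'l \<Rightarrow> 'b::generalized_boolean_algebra \<Rightarrow> 'b"
    and \<I> :: "'l \<Rightarrow> 'b set"
    and \<J> :: "'b set"
  assumes morphism: "\<alpha> \<in> L \<Longrightarrow> gba_morphism (\<theta> \<alpha>)"
    and ideal_I: "\<alpha> \<in> L \<Longrightarrow> gba_ideal (\<I> \<alpha>)"
    and range_I: "\<alpha> \<in> L \<Longrightarrow> {A. \<exists>B. A \<le> \<theta> \<alpha> B} \<subseteq> \<I> \<alpha>"
    and ideal_J: "gba_ideal \<J>"
    and J_regular: "\<J> \<subseteq> regular L \<theta>"


section \<open>Free algebras\<close>

datatype 'g free_word = Word (letters: "'g list")

instantiation free_word :: (type) monoid_add
begin

definition zero_free_word :: "'a free_word" where "0 = Word []"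

definition plus_free_word :: "'a free_word \<Rightarrow> 'a free_word \<Rightarrow> 'a free_word" where
  "u + v = Word (letters u @ letters v)"

instance
  by standard (simp_all add: zero_free_word_def plus_free_word_def)

end

text \<open>With concatenation as the addition of the exponent monoid, the convolution product of
  \<^typ>\<open>'g free_word \<Rightarrow>\<^sub>0 'r\<close> is the product of noncommutative polynomials. The free
  non-unital associative algebra on a set \<open>X\<close> of generators consists of the polynomials supported
  on nonempty words with letters in \<open>X\<close>. The sort of \<open>'r\<close> describes commutative rings with an
  identity; unlike \<^class>\<open>comm_ring_1\<close> it does not exclude the zero ring.\<close>

type_synonym ('g, 'r) nc_poly = "'g free_word \<Rightarrow>\<^sub>0 'r"

definition free_algebra :: "'g set \<Rightarrow> ('g, 'r::{comm_ring, comm_monoid_mult}) nc_poly set" where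
  "free_algebra X = {x. \<forall>w \<in> Poly_Mapping.keys x. letters w \<noteq> [] \<and> set (letters w) \<subseteq> X}"

definition nc_scale ::
    "'r \<Rightarrow> ('g, 'r::{comm_ring, comm_monoid_mult}) nc_poly \<Rightarrow> ('g, 'r) nc_poly" where
  "nc_scale r x = Poly_Mapping.map (\<lambda>c. r * c) x"

definition nc_gen :: "'g \<Rightarrow> ('g, 'r::{comm_ring, comm_monoid_mult}) nc_poly" where
  "nc_gen g = Poly_Mapping.single (Word [g]) 1"

text \<open>The algebra ideal of \<open>free_algebra X\<close> generated by the differences \<open>x - y\<close>, for
  \<open>(x, y)\<close> ranging over a set \<open>E\<close> of equations.\<close>

inductive_set generated_ideal ::
    "'g set \<Rightarrow> (('g, 'r::{comm_ring, comm_monoid_mult}) nc_poly \<times> ('g, 'r) nc_poly) set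
      \<Rightarrow> ('g, 'r) nc_poly set"
  for X and E where
    relator: "(x, y) \<in> E \<Longrightarrow> x - y \<in> generated_ideal X E"
  | zero: "0 \<in> generated_ideal X E"
  | add: "x \<in> generated_ideal X E \<Longrightarrow> y \<in> generated_ideal X E \<Longrightarrow> x + y \<in> generated_ideal X E"
  | scale: "x \<in> generated_ideal X E \<Longrightarrow> nc_scale r x \<in> generated_ideal X E"
  | mult_left: "x \<in> generated_ideal X E \<Longrightarrow> a \<in> free_algebra X \<Longrightarrow> a * x \<in> generated_ideal X E"
  | mult_right: "x \<in> generated_ideal X E \<Longrightarrow> a \<in> free_algebra X \<Longrightarrow> x * a \<in> generated_ideal X E"


section \<open>The algebra of a relative generalized Boolean dynamical system\<close>

text \<open>\<open>GenP A\<close>, \<open>GenS \<alpha> B\<close> and \<open>GenT \<alpha> B\<close> stand for $p_A$, $s_{\alpha,B}$ and $s_{\alpha,B}^*$.\<close>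

datatype ('b, 'l) gbds_gen = GenP 'b | GenS 'l 'b | GenT 'l 'b

type_synonym ('b, 'l, 'r) gbds_poly = "(('b, 'l) gbds_gen, 'r) nc_poly"

abbreviation polyP :: "'b \<Rightarrow> ('b, 'l, 'r::{comm_ring, comm_monoid_mult}) gbds_poly" where
  "polyP A \<equiv> nc_gen (GenP A)"

abbreviation polyS :: "'l \<Rightarrow> 'b \<Rightarrow> ('b, 'l, 'r::{comm_ring, comm_monoid_mult}) gbds_poly" where
  "polyS \<alpha> B \<equiv> nc_gen (GenS \<alpha> B)"

abbreviation polyT :: "'l \<Rightarrow> 'b \<Rightarrow> ('b, 'l, 'r::{comm_ring, comm_monoid_mult}) gbds_poly" where
  "polyT \<alpha> B \<equiv> nc_gen (GenT \<alpha> B)"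

definition gbds_gens :: "'l set \<Rightarrow> ('l \<Rightarrow> 'b set) \<Rightarrow> ('b, 'l) gbds_gen set" where
  "gbds_gens L \<I> = range GenP \<union> {GenS \<alpha> B |\<alpha> B. \<alpha> \<in> L \<and> B \<in> \<I> \<alpha>} \<union> {GenT \<alpha> B |\<alpha> B. \<alpha> \<in> L \<and> B \<in> \<I> \<alpha>}"

inductive_set gbds_relations ::
    "'l set \<Rightarrow> ('l \<Rightarrow> 'b::generalized_boolean_algebra \<Rightarrow> 'b) \<Rightarrow> ('l \<Rightarrow> 'b set) \<Rightarrow> 'b set
      \<Rightarrow> (('b, 'l, 'r::{comm_ring, comm_monoid_mult}) gbds_poly \<times> ('b, 'l, 'r) gbds_poly) set"
  for L \<theta> \<I> \<J> where
    P_bot: "(polyP bot, 0) \<in> gbds_relations L \<theta> \<I> \<J>"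
  | P_inf: "(polyP (inf A A'), polyP A * polyP A') \<in> gbds_relations L \<theta> \<I> \<J>"
  | P_sup: "(polyP (sup A A'), polyP A + polyP A' - polyP (inf A A')) \<in> gbds_relations L \<theta> \<I> \<J>"
  | P_S: "\<alpha> \<in> L \<Longrightarrow> B \<in> \<I> \<alpha> \<Longrightarrow>
      (polyP A * polyS \<alpha> B, polyS \<alpha> B * polyP (\<theta> \<alpha> A)) \<in> gbds_relations L \<theta> \<I> \<J>"
  | T_P: "\<alpha> \<in> L \<Longrightarrow> B \<in> \<I> \<alpha> \<Longrightarrow>
      (polyT \<alpha> B * polyP A, polyP (\<theta> \<alpha> A) * polyT \<alpha> B) \<in> gbds_relations L \<theta> \<I> \<J>"
  | T_S: "\<alpha> \<in> L \<Longrightarrow> B \<in> \<I> \<alpha> \<Longrightarrow> \<alpha>' \<in> L \<Longrightarrow> B' \<in> \<I> \<alpha>' \<Longrightarrow>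
      (polyT \<alpha> B * polyS \<alpha>' B', if \<alpha> = \<alpha>' then polyP (inf B B') else 0) \<in> gbds_relations L \<theta> \<I> \<J>"
  | S_inf: "\<alpha> \<in> L \<Longrightarrow> B \<in> \<I> \<alpha> \<Longrightarrow>
      (polyS \<alpha> B * polyP B', polyS \<alpha> (inf B B')) \<in> gbds_relations L \<theta> \<I> \<J>"
  | T_inf: "\<alpha> \<in> L \<Longrightarrow> B \<in> \<I> \<alpha> \<Longrightarrow>
      (polyP B' * polyT \<alpha> B, polyT \<alpha> (inf B B')) \<in> gbds_relations L \<theta> \<I> \<J>"
  | P_sum: "A \<in> \<J> \<Longrightarrow>
      (polyP A, \<Sum>\<alpha> \<in> Delta L \<theta> A. polyS \<alpha> (\<theta> \<alpha> A) * polyT \<alpha> (\<theta> \<alpha> A)) \<in> gbds_relations L \<theta> \<I> \<J>"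

text \<open>The algebra $L_R(\mathcal B,\mathcal L,\theta,\mathcal I,\mathcal J)$ is the quotient of the
  free algebra by the ideal generated by the relations. Its carrier depends on the system, so its
  elements are the classes of the congruence below and its operations are given on classes.\<close>

definition LR_cong ::
    "'l set \<Rightarrow> ('l \<Rightarrow> 'b::generalized_boolean_algebra \<Rightarrow> 'b) \<Rightarrow> ('l \<Rightarrow> 'b set) \<Rightarrow> 'b set
      \<Rightarrow> ('b, 'l, 'r::{comm_ring, comm_monoid_mult}) gbds_poly rel" where
  "LR_cong L \<theta> \<I> \<J> = {(x, y). x \<in> free_algebra (gbds_gens L \<I>) \<and> y \<in> free_algebra (gbds_gens L \<I>) \<and>
     x - y \<in> generated_ideal (gbds_gens L \<I>) (gbds_relations L \<theta> \<I> \<J>)}"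

definition LR_carrier ::
    "'l set \<Rightarrow> ('l \<Rightarrow> 'b::generalized_boolean_algebra \<Rightarrow> 'b) \<Rightarrow> ('l \<Rightarrow> 'b set) \<Rightarrow> 'b set
      \<Rightarrow> ('b, 'l, 'r::{comm_ring, comm_monoid_mult}) gbds_poly set set" where
  "LR_carrier L \<theta> \<I> \<J> = free_algebra (gbds_gens L \<I>) // LR_cong L \<theta> \<I> \<J>"

definition LR_class ::
    "'l set \<Rightarrow> ('l \<Rightarrow> 'b::generalized_boolean_algebra \<Rightarrow> 'b) \<Rightarrow> ('l \<Rightarrow> 'b set) \<Rightarrow> 'b set
      \<Rightarrow> ('b, 'l, 'r::{comm_ring, comm_monoid_mult}) gbds_poly \<Rightarrow> ('b, 'l, 'r) gbds_poly set" where
  "LR_class L \<theta> \<I> \<J> x = LR_cong L \<theta> \<I> \<J> `` {x}"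

definition LR_add ::
    "'l set \<Rightarrow> ('l \<Rightarrow> 'b::generalized_boolean_algebra \<Rightarrow> 'b) \<Rightarrow> ('l \<Rightarrow> 'b set) \<Rightarrow> 'b set
      \<Rightarrow> ('b, 'l, 'r::{comm_ring, comm_monoid_mult}) gbds_poly set \<Rightarrow> ('b, 'l, 'r) gbds_poly set
      \<Rightarrow> ('b, 'l, 'r) gbds_poly set" where
  "LR_add L \<theta> \<I> \<J> U V = (\<Union>x\<in>U. \<Union>y\<in>V. LR_class L \<theta> \<I> \<J> (x + y))"

definition LR_mult ::
    "'l set \<Rightarrow> ('l \<Rightarrow> 'b::generalized_boolean_algebra \<Rightarrow> 'b) \<Rightarrow> ('l \<Rightarrow> 'b set) \<Rightarrow> 'b set
      \<Rightarrow> ('b, 'l, 'r::{comm_ring, comm_monoid_mult}) gbds_poly set \<Rightarrow> ('b, 'l, 'r) gbds_poly set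
      \<Rightarrow> ('b, 'l, 'r) gbds_poly set" where
  "LR_mult L \<theta> \<I> \<J> U V = (\<Union>x\<in>U. \<Union>y\<in>V. LR_class L \<theta> \<I> \<J> (x * y))"

definition LR_scale ::
    "'l set \<Rightarrow> ('l \<Rightarrow> 'b::generalized_boolean_algebra \<Rightarrow> 'b) \<Rightarrow> ('l \<Rightarrow> 'b set) \<Rightarrow> 'b set
      \<Rightarrow> 'r \<Rightarrow> ('b, 'l, 'r::{comm_ring, comm_monoid_mult}) gbds_poly set
      \<Rightarrow> ('b, 'l, 'r) gbds_poly set" where
  "LR_scale L \<theta> \<I> \<J> r U = (\<Union>x\<in>U. LR_class L \<theta> \<I> \<J> (nc_scale r x))"

definition LR_p ::
    "'l set \<Rightarrow> ('l \<Rightarrow> 'b::generalized_boolean_algebra \<Rightarrow> 'b) \<Rightarrow> ('l \<Rightarrow> 'b set) \<Rightarrow> 'b set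
      \<Rightarrow> 'b \<Rightarrow> ('b, 'l, 'r::{comm_ring, comm_monoid_mult}) gbds_poly set" where
  "LR_p L \<theta> \<I> \<J> A = LR_class L \<theta> \<I> \<J> (polyP A)"

text \<open>Only meaningful when \<open>Delta L \<theta> A\<close> is finite.\<close>

definition LR_q ::
    "'l set \<Rightarrow> ('l \<Rightarrow> 'b::generalized_boolean_algebra \<Rightarrow> 'b) \<Rightarrow> ('l \<Rightarrow> 'b set) \<Rightarrow> 'b set
      \<Rightarrow> 'b \<Rightarrow> ('b, 'l, 'r::{comm_ring, comm_monoid_mult}) gbds_poly set" where
  "LR_q L \<theta> \<I> \<J> A = LR_class L \<theta> \<I> \<J>
     (polyP A - (\<Sum>\<alpha> \<in> Delta L \<theta> A. polyS \<alpha> (\<theta> \<alpha> A) * polyT \<alpha> (\<theta> \<alpha> A)))"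

fun gen_degree :: "('b, 'l) gbds_gen \<Rightarrow> int" where
  "gen_degree (GenP A) = 0"
| "gen_degree (GenS \<alpha> B) = 1"
| "gen_degree (GenT \<alpha> B) = -1"

definition word_degree :: "('b, 'l) gbds_gen free_word \<Rightarrow> int" where
  "word_degree w = sum_list (map gen_degree (letters w))"

definition LR_component ::
    "'l set \<Rightarrow> ('l \<Rightarrow> 'b::generalized_boolean_algebra \<Rightarrow> 'b) \<Rightarrow> ('l \<Rightarrow> 'b set) \<Rightarrow> 'b set
      \<Rightarrow> int \<Rightarrow> ('b, 'l, 'r::{comm_ring, comm_monoid_mult}) gbds_poly set set" where
  "LR_component L \<theta> \<I> \<J> n = LR_class L \<theta> \<I> \<J> `
     {x \<in> free_algebra (gbds_gens L \<I>). \<forall>w \<in> Poly_Mapping.keys x. word_degree w = n}"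


section \<open>Graded algebras and graded homomorphisms\<close>

text \<open>Associative, not necessarily unital algebras; the library locale \<^locale>\<open>module\<close> is not used
  because it requires \<^class>\<open>comm_ring_1\<close>.\<close>

locale r_algebra =
  fixes scale :: "'r::{comm_ring, comm_monoid_mult} \<Rightarrow> 'a::ring \<Rightarrow> 'a"
  assumes scale_right_distrib: "scale r (a + b) = scale r a + scale r b"
    and scale_left_distrib: "scale (r + s) a = scale r a + scale s a"
    and scale_scale: "scale r (scale s a) = scale (r * s) a"
    and scale_one: "scale 1 a = a"
    and mult_scale_left: "scale r a * b = scale r (a * b)"
    and mult_scale_right: "a * scale r b = scale r (a * b)"

locale Z_graded_algebra = r_algebra scale
  for scale :: "'r::{comm_ring, comm_monoid_mult} \<Rightarrow> 'a::ring \<Rightarrow> 'a" +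
  fixes gr :: "int \<Rightarrow> 'a set"
  assumes zero_mem: "0 \<in> gr n"
    and add_mem: "a \<in> gr n \<Longrightarrow> b \<in> gr n \<Longrightarrow> a + b \<in> gr n"
    and scale_mem: "a \<in> gr n \<Longrightarrow> scale r a \<in> gr n"
    and mult_mem: "a \<in> gr m \<Longrightarrow> b \<in> gr n \<Longrightarrow> a * b \<in> gr (m + n)"
    and direct_sum: "\<exists>!c. (\<forall>n. c n \<in> gr n) \<and> finite {n. c n \<noteq> 0} \<and> a = (\<Sum>n | c n \<noteq> 0. c n)"

definition LR_algebra_hom ::
    "'l set \<Rightarrow> ('l \<Rightarrow> 'b::generalized_boolean_algebra \<Rightarrow> 'b) \<Rightarrow> ('l \<Rightarrow> 'b set) \<Rightarrow> 'b set
      \<Rightarrow> ('r \<Rightarrow> 'a::ring \<Rightarrow> 'a)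
      \<Rightarrow> (('b, 'l, 'r::{comm_ring, comm_monoid_mult}) gbds_poly set \<Rightarrow> 'a) \<Rightarrow> bool" where
  "LR_algebra_hom L \<theta> \<I> \<J> scale f \<longleftrightarrow>
     (\<forall>U \<in> LR_carrier L \<theta> \<I> \<J>. \<forall>V \<in> LR_carrier L \<theta> \<I> \<J>.
        f (LR_add L \<theta> \<I> \<J> U V) = f U + f V \<and> f (LR_mult L \<theta> \<I> \<J> U V) = f U * f V) \<and>
     (\<forall>r. \<forall>U \<in> LR_carrier L \<theta> \<I> \<J>. f (LR_scale L \<theta> \<I> \<J> r U) = scale r (f U))"

definition LR_graded_hom ::
    "'l set \<Rightarrow> ('l \<Rightarrow> 'b::generalized_boolean_algebra \<Rightarrow> 'b) \<Rightarrow> ('l \<Rightarrow> 'b set) \<Rightarrow> 'b set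
      \<Rightarrow> ('r \<Rightarrow> 'a::ring \<Rightarrow> 'a) \<Rightarrow> (int \<Rightarrow> 'a set)
      \<Rightarrow> (('b, 'l, 'r::{comm_ring, comm_monoid_mult}) gbds_poly set \<Rightarrow> 'a) \<Rightarrow> bool" where
  "LR_graded_hom L \<theta> \<I> \<J> scale gr f \<longleftrightarrow>
     LR_algebra_hom L \<theta> \<I> \<J> scale f \<and> (\<forall>n. f ` LR_component L \<theta> \<I> \<J> n \<subseteq> gr n)"


section \<open>The operations are well defined on classes\<close>

lemma nc_scale_lookup: "Poly_Mapping.lookup (nc_scale r x) w = r * Poly_Mapping.lookup x w"
  unfolding nc_scale_def by transfer (simp add: when_def)

lemma keys_nc_scale: "Poly_Mapping.keys (nc_scale r x) \<subseteq> Poly_Mapping.keys x"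
  by (auto simp: in_keys_iff nc_scale_lookup)

lemma nc_scale_minus_one: "nc_scale (- 1) x = - x"
  by (rule poly_mapping_eqI) (simp add: nc_scale_lookup)

lemma nc_scale_diff: "nc_scale r (x - y) = nc_scale r x - nc_scale r y"
  by (rule poly_mapping_eqI) (simp add: nc_scale_lookup lookup_minus right_diff_distrib)

lemma free_algebra_add:
  "x \<in> free_algebra X \<Longrightarrow> y \<in> free_algebra X \<Longrightarrow> x + y \<in> free_algebra X"
  unfolding free_algebra_def using keys_add[of x y] by blast

lemma free_algebra_scale: "x \<in> free_algebra X \<Longrightarrow> nc_scale r x \<in> free_algebra X"
  unfolding free_algebra_def using keys_nc_scale[of r x] by blast

lemma free_algebra_mult:
  assumes "x \<in> free_algebra X" "y \<in> free_algebra X"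
  shows "x * y \<in> free_algebra X"
  unfolding free_algebra_def
proof (clarify, intro conjI)
  fix w assume "w \<in> Poly_Mapping.keys (x * y)"
  then obtain u v where "w = u + v" "u \<in> Poly_Mapping.keys x" "v \<in> Poly_Mapping.keys y"
    using keys_mult[of x y] by blast
  with assms show "letters w \<noteq> []" "set (letters w) \<subseteq> X"
    unfolding free_algebra_def by (auto simp: plus_free_word_def)
qed

lemma generated_ideal_uminus: "x \<in> generated_ideal X E \<Longrightarrow> - x \<in> generated_ideal X E"
  using generated_ideal.scale[of x X E "- 1"] by (simp add: nc_scale_minus_one)

lemma equiv_LR_cong: "equiv (free_algebra (gbds_gens L \<I>)) (LR_cong L \<theta> \<I> \<J>)"
proof (rule equivI)
  let ?I = "generated_ideal (gbds_gens L \<I>) (gbds_relations L \<theta> \<I> \<J>)"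
  show "sym (LR_cong L \<theta> \<I> \<J>)"
  proof (rule symI)
    fix x y assume "(x, y) \<in> LR_cong L \<theta> \<I> \<J>"
    then show "(y, x) \<in> LR_cong L \<theta> \<I> \<J>"
      using generated_ideal_uminus[of "x - y"] by (auto simp: LR_cong_def)
  qed
  show "trans (LR_cong L \<theta> \<I> \<J>)"
  proof (rule transI)
    fix x y z assume "(x, y) \<in> LR_cong L \<theta> \<I> \<J>" "(y, z) \<in> LR_cong L \<theta> \<I> \<J>"
    then show "(x, z) \<in> LR_cong L \<theta> \<I> \<J>"
      using generated_ideal.add[of "x - y" _ _ "y - z"] by (auto simp: LR_cong_def)
  qed
qed (auto simp: LR_cong_def refl_on_def generated_ideal.zero)

lemma LR_class_eq:
  assumes "(x, y) \<in> LR_cong L \<theta> \<I> \<J>"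
  shows "LR_class L \<theta> \<I> \<J> x = LR_class L \<theta> \<I> \<J> y"
  unfolding LR_class_def by (rule equiv_class_eq[OF equiv_LR_cong assms])

lemma LR_class_mem:
  assumes "x \<in> free_algebra (gbds_gens L \<I>)"
  shows "LR_class L \<theta> \<I> \<J> x \<in> LR_carrier L \<theta> \<I> \<J>"
  using assms by (simp add: LR_class_def LR_carrier_def quotientI)

lemma LR_add_class:
  assumes "x \<in> free_algebra (gbds_gens L \<I>)" "y \<in> free_algebra (gbds_gens L \<I>)"
  shows "LR_add L \<theta> \<I> \<J> (LR_class L \<theta> \<I> \<J> x) (LR_class L \<theta> \<I> \<J> y) = LR_class L \<theta> \<I> \<J> (x + y)"
proof -
  have "LR_class L \<theta> \<I> \<J> (x' + y') = LR_class L \<theta> \<I> \<J> (x + y)"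
    if "(x, x') \<in> LR_cong L \<theta> \<I> \<J>" "(y, y') \<in> LR_cong L \<theta> \<I> \<J>" for x' y'
    using that generated_ideal.add[of "x - x'" _ _ "y - y'"]
    by (intro LR_class_eq[symmetric]) (auto simp: LR_cong_def free_algebra_add add_diff_add)
  moreover have "(x, x) \<in> LR_cong L \<theta> \<I> \<J>" "(y, y) \<in> LR_cong L \<theta> \<I> \<J>"
    using assms by (auto simp: LR_cong_def generated_ideal.zero)
  ultimately show ?thesis
    unfolding LR_add_def LR_class_def[of L \<theta> \<I> \<J> x] LR_class_def[of L \<theta> \<I> \<J> y] by blast
qed

lemma LR_mult_class:
  assumes "x \<in> free_algebra (gbds_gens L \<I>)" "y \<in> free_algebra (gbds_gens L \<I>)"
  shows "LR_mult L \<theta> \<I> \<J> (LR_class L \<theta> \<I> \<J> x) (LR_class L \<theta> \<I> \<J> y) = LR_class L \<theta> \<I> \<J> (x * y)"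
proof -
  have "LR_class L \<theta> \<I> \<J> (x' * y') = LR_class L \<theta> \<I> \<J> (x * y)"
    if that: "(x, x') \<in> LR_cong L \<theta> \<I> \<J>" "(y, y') \<in> LR_cong L \<theta> \<I> \<J>" for x' y'
  proof -
    have "x * y - x' * y' = (x - x') * y + x' * (y - y')"
      by (simp add: algebra_simps)
    then show ?thesis
      using that by (intro LR_class_eq[symmetric])
        (auto simp: LR_cong_def free_algebra_mult
          intro: generated_ideal.add generated_ideal.mult_left generated_ideal.mult_right)
  qed
  moreover have "(x, x) \<in> LR_cong L \<theta> \<I> \<J>" "(y, y) \<in> LR_cong L \<theta> \<I> \<J>"
    using assms by (auto simp: LR_cong_def generated_ideal.zero)
  ultimately show ?thesis
    unfolding LR_mult_def LR_class_def[of L \<theta> \<I> \<J> x] LR_class_def[of L \<theta> \<I> \<J> y] by blast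
qed

lemma LR_scale_class:
  assumes "x \<in> free_algebra (gbds_gens L \<I>)"
  shows "LR_scale L \<theta> \<I> \<J> r (LR_class L \<theta> \<I> \<J> x) = LR_class L \<theta> \<I> \<J> (nc_scale r x)"
proof -
  have "LR_class L \<theta> \<I> \<J> (nc_scale r x') = LR_class L \<theta> \<I> \<J> (nc_scale r x)"
    if "(x, x') \<in> LR_cong L \<theta> \<I> \<J>" for x'
    using that generated_ideal.scale[of "x - x'"]
    by (intro LR_class_eq[symmetric]) (auto simp: LR_cong_def free_algebra_scale nc_scale_diff)
  moreover have "(x, x) \<in> LR_cong L \<theta> \<I> \<J>"
    using assms by (auto simp: LR_cong_def generated_ideal.zero)
  ultimately show ?thesis
    unfolding LR_scale_def LR_class_def[of L \<theta> \<I> \<J> x] by blast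
qed

end

theory Submission
  imports Defs
begin

text \<open>
  \<^bold>\<open>Nonvanishing implies injectivity.\<close> By the relations, the algebra is spanned by the monomials
  $s_{\alpha_1,B_1}\cdots s_{\alpha_m,B_m}\,p_A\,s_{\beta_n,C_n}^*\cdots s_{\beta_1,C_1}^*$, which have
  degree $m-n$. The kernel \<open>K\<close> of a graded homomorphism contains the homogeneous components of its
  elements, so only homogeneous elements of \<open>K\<close> are considered. The main tool is the idempotent
  $e=\sum_\alpha s_{\alpha,C_\alpha}s_{\alpha,C_\alpha}^*$ for a finitely supported family \<open>C\<close>. It is a
  one-sided unit for elements of nonzero degree, which allows an induction on the length of the monomials
  through the elements $s_{\alpha,B}^*x$, respectively $xs_{\alpha,B}$. In degree \<open>0\<close>, the induction
  applied to $s_{\alpha,B}^*xs_{\beta,B'}$ leaves the elements $x=z-ze$ with \<open>z\<close> in the span of the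
  $p_A$, and a Boolean decomposition reduces these to $z=rp_A$ (\<open>K_cut_p_span\<close>). For such an element of
  \<open>K\<close>, the hypothesis on the $p_B$ forces \<open>A\<close> to be regular and $x=rq_A$ (\<open>K_cut_p\<close>); by the hypothesis
  on the $q_A$ then $A\in\mathcal J$, so $x=0$. The result is \<open>homogeneous_kernel\<close>, which holds in any
  representation of the relations.

  \<^bold>\<open>Injectivity implies nonvanishing.\<close> This amounts to $rp_A\neq0$ and $rq_A\neq0$ in the algebra itself,
  for which a representation is needed that shows it. The generators act by partial maps on the boundary
  paths, the finite or infinite sequences of characters of $\mathcal B$ connected by labels that stop only
  outside the open set defined by $\mathcal J$. There are enough of them by the prime ideal theorem
  and because a character that is nonzero on an element of $\mathcal J$ can be extended by a
  further label (\<open>exists_boundary_path\<close>).\<close>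

section \<open>Generalized Boolean algebras and algebras over a ring\<close>

context generalized_boolean_algebra
begin

subclass bounded_lattice_bot ..

lemma diff_le: "x - y \<le> x"
  using sup_relcomp[of x y] by (metis sup.cobounded2)

lemma diff_eq_bot_imp_le: "x - y = bot \<Longrightarrow> x \<le> y"
  using sup_relcomp[of x y] by (metis inf.cobounded2 sup_bot_right)

end

context relative_gbds
begin

lemma theta_bot: "\<alpha> \<in> L \<Longrightarrow> \<theta> \<alpha> bot = bot"
  and theta_sup: "\<alpha> \<in> L \<Longrightarrow> \<theta> \<alpha> (sup A B) = sup (\<theta> \<alpha> A) (\<theta> \<alpha> B)"
  and theta_inf: "\<alpha> \<in> L \<Longrightarrow> \<theta> \<alpha> (inf A B) = inf (\<theta> \<alpha> A) (\<theta> \<alpha> B)"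
  and theta_diff: "\<alpha> \<in> L \<Longrightarrow> \<theta> \<alpha> (A - B) = \<theta> \<alpha> A - \<theta> \<alpha> B"
  using morphism by (auto simp: gba_morphism_def)

lemma theta_mono: "\<alpha> \<in> L \<Longrightarrow> A \<le> B \<Longrightarrow> \<theta> \<alpha> A \<le> \<theta> \<alpha> B"
  using theta_inf[of \<alpha> A B] by (simp add: inf_absorb1 le_iff_inf)

lemma theta_mem_I: "\<alpha> \<in> L \<Longrightarrow> \<theta> \<alpha> A \<in> \<I> \<alpha>"
  using range_I by blast

lemma bot_mem_I: "\<alpha> \<in> L \<Longrightarrow> bot \<in> \<I> \<alpha>"
  using theta_mem_I[of \<alpha> bot] by (simp add: theta_bot)

lemma inf_mem_I: "\<alpha> \<in> L \<Longrightarrow> A \<in> \<I> \<alpha> \<Longrightarrow> inf A B \<in> \<I> \<alpha>"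
  using ideal_I by (auto simp: gba_ideal_def)

lemma sup_mem_I: "\<alpha> \<in> L \<Longrightarrow> A \<in> \<I> \<alpha> \<Longrightarrow> B \<in> \<I> \<alpha> \<Longrightarrow> sup A B \<in> \<I> \<alpha>"
  using ideal_I by (auto simp: gba_ideal_def)

end

context r_algebra
begin

lemma scale_zero_right: "scale r 0 = 0"
  using scale_right_distrib[of r 0 0] by simp

lemma scale_zero_left: "scale 0 x = 0"
  using scale_left_distrib[of 0 0 x] by simp

lemma scale_minus_right: "scale r (- x) = - scale r x"
  using scale_right_distrib[of r x "- x"]
  by (simp add: scale_zero_right eq_neg_iff_add_eq_0 add.commute)

lemma scale_diff_right: "scale r (x - y) = scale r x - scale r y"
  using scale_right_distrib[of r x "- y"] by (simp add: scale_minus_right)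

end

section \<open>Representations and monomials\<close>

text \<open>A family of elements of an algebra that satisfies the defining relations of
  $L_R(\mathcal B,\mathcal L,\theta,\mathcal I,\mathcal J)$; \<open>t \<alpha> B\<close> is the image of
  $s_{\alpha,B}^*$.\<close>

locale gbds_representation = relative_gbds L \<theta> \<I> \<J> + r_algebra scale
  for L :: "'l set" and \<theta> :: "'l \<Rightarrow> 'b::generalized_boolean_algebra \<Rightarrow> 'b"
    and \<I> :: "'l \<Rightarrow> 'b set" and \<J> :: "'b set"
    and scale :: "'r::{comm_ring, comm_monoid_mult} \<Rightarrow> 'a::ring \<Rightarrow> 'a" +
  fixes p :: "'b \<Rightarrow> 'a" and s t :: "'l \<Rightarrow> 'b \<Rightarrow> 'a"
  assumes p_bot: "p bot = 0"
    and p_inf: "p (inf A A') = p A * p A'"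
    and p_sup: "p (sup A A') = p A + p A' - p (inf A A')"
    and p_s: "\<alpha> \<in> L \<Longrightarrow> B \<in> \<I> \<alpha> \<Longrightarrow> p A * s \<alpha> B = s \<alpha> B * p (\<theta> \<alpha> A)"
    and t_p: "\<alpha> \<in> L \<Longrightarrow> B \<in> \<I> \<alpha> \<Longrightarrow> t \<alpha> B * p A = p (\<theta> \<alpha> A) * t \<alpha> B"
    and t_s: "\<alpha> \<in> L \<Longrightarrow> B \<in> \<I> \<alpha> \<Longrightarrow> \<alpha>' \<in> L \<Longrightarrow> B' \<in> \<I> \<alpha>' \<Longrightarrow>
      t \<alpha> B * s \<alpha>' B' = (if \<alpha> = \<alpha>' then p (inf B B') else 0)"
    and s_inf: "\<alpha> \<in> L \<Longrightarrow> B \<in> \<I> \<alpha> \<Longrightarrow> s \<alpha> B * p B' = s \<alpha> (inf B B')"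
    and t_inf: "\<alpha> \<in> L \<Longrightarrow> B \<in> \<I> \<alpha> \<Longrightarrow> p B' * t \<alpha> B = t \<alpha> (inf B B')"
    and p_sum: "A \<in> \<J> \<Longrightarrow> p A = (\<Sum>\<alpha> \<in> Delta L \<theta> A. s \<alpha> (\<theta> \<alpha> A) * t \<alpha> (\<theta> \<alpha> A))"
begin

text \<open>Only meaningful when \<open>Delta L \<theta> A\<close> is finite.\<close>

definition q :: "'b \<Rightarrow> 'a" where
  "q A = p A - (\<Sum>\<alpha> \<in> Delta L \<theta> A. s \<alpha> (\<theta> \<alpha> A) * t \<alpha> (\<theta> \<alpha> A))"

lemma p_split: "p A = p (inf A B) + p (A - B)"
  using p_sup[of "inf A B" "A - B"] inf_relcomp[of B A]
  by (simp add: sup_relcomp p_bot inf.assoc)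

lemma s_bot: "\<alpha> \<in> L \<Longrightarrow> s \<alpha> bot = 0"
  using s_inf[of \<alpha> bot bot] by (simp add: bot_mem_I p_bot)

lemma t_bot: "\<alpha> \<in> L \<Longrightarrow> t \<alpha> bot = 0"
  using t_inf[of \<alpha> bot bot] by (simp add: bot_mem_I p_bot)

lemma s_p_self: "\<alpha> \<in> L \<Longrightarrow> B \<in> \<I> \<alpha> \<Longrightarrow> s \<alpha> B * p B = s \<alpha> B"
  by (simp add: s_inf)

lemma p_t_self: "\<alpha> \<in> L \<Longrightarrow> B \<in> \<I> \<alpha> \<Longrightarrow> p B * t \<alpha> B = t \<alpha> B"
  by (simp add: t_inf)

lemma s_inf': "\<alpha> \<in> L \<Longrightarrow> B \<in> \<I> \<alpha> \<Longrightarrow> s \<alpha> B * (p B' * x) = s \<alpha> (inf B B') * x"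
  by (metis mult.assoc s_inf)

text \<open>\<open>monomial m n y\<close> says that \<open>y\<close> is zero or a product of \<open>m\<close> factors \<open>s\<close>, one factor \<open>p\<close> and
  \<open>n\<close> factors \<open>t\<close>, in this order. Zero is included because the relations can annihilate a
  product.\<close>

inductive monomial :: "nat \<Rightarrow> nat \<Rightarrow> 'a \<Rightarrow> bool" where
  zero: "monomial m n 0"
| p: "monomial 0 0 (p A)"
| s: "monomial m n y \<Longrightarrow> \<alpha> \<in> L \<Longrightarrow> B \<in> \<I> \<alpha> \<Longrightarrow> monomial (Suc m) n (s \<alpha> B * y)"
| t: "monomial m n y \<Longrightarrow> \<alpha> \<in> L \<Longrightarrow> B \<in> \<I> \<alpha> \<Longrightarrow> monomial m (Suc n) (y * t \<alpha> B)"

lemma monomial_p_left: "monomial m n y \<Longrightarrow> monomial m n (p A * y)"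
proof (induction arbitrary: A rule: monomial.induct)
  case (s m n y \<alpha> B)
  have "p A * (s \<alpha> B * y) = s \<alpha> B * (p (\<theta> \<alpha> A) * y)"
    using s by (metis mult.assoc p_s)
  with s show ?case by (simp add: monomial.s)
next
  case (t m n y \<alpha> B)
  then show ?case by (simp add: mult.assoc[symmetric] monomial.t)
qed (auto intro: monomial.intros simp flip: p_inf)

lemma monomial_p_right: "monomial m n y \<Longrightarrow> monomial m n (y * p A)"
proof (induction arbitrary: A rule: monomial.induct)
  case (t m n y \<alpha> B)
  have "(y * t \<alpha> B) * p A = (y * p (\<theta> \<alpha> A)) * t \<alpha> B"
    using t by (metis mult.assoc t_p)
  with t show ?case by (simp add: monomial.t)
next
  case (s m n y \<alpha> B)
  then show ?case by (simp add: mult.assoc monomial.s)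
qed (auto intro: monomial.intros simp flip: p_inf)

lemma monomial_t_left:
  assumes "\<alpha> \<in> L" "B \<in> \<I> \<alpha>"
  shows "monomial (Suc m) n y \<Longrightarrow> monomial m n (t \<alpha> B * y)"
proof (induction "Suc m" n y rule: monomial.induct)
  case (s n y \<beta> C)
  have "t \<alpha> B * (s \<beta> C * y) = (if \<alpha> = \<beta> then p (inf B C) * y else 0)"
    using assms s t_s[of \<alpha> B \<beta> C] by (simp flip: mult.assoc)
  with s show ?case by (auto intro: monomial.zero monomial_p_left)
next
  case (t n y \<beta> C)
  then show ?case by (simp add: mult.assoc[symmetric] monomial.t)
qed (auto intro: monomial.zero)

lemma monomial_s_right:
  assumes "\<alpha> \<in> L" "B \<in> \<I> \<alpha>"
  shows "monomial m (Suc n) y \<Longrightarrow> monomial m n (y * s \<alpha> B)"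
proof (induction m "Suc n" y rule: monomial.induct)
  case (t m y \<beta> C)
  have "(y * t \<beta> C) * s \<alpha> B = (if \<beta> = \<alpha> then y * p (inf C B) else 0)"
    using assms t t_s[of \<beta> C \<alpha> B] by (simp add: mult.assoc)
  with t show ?case by (auto intro: monomial.zero monomial_p_right)
next
  case (s m y \<beta> C)
  then show ?case by (simp add: mult.assoc monomial.s)
qed (auto intro: monomial.zero)

lemma monomial_t_left_0:
  assumes "\<alpha> \<in> L" "B \<in> \<I> \<alpha>"
  shows "monomial 0 n y \<Longrightarrow> monomial 0 (Suc n) (t \<alpha> B * y)"
proof (induction "0::nat" n y rule: monomial.induct)
  case (p A)
  then show ?case using assms monomial.t[OF monomial.p, of \<alpha> B] by (simp add: t_p)
next
  case (t n y \<beta> C)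
  then show ?case by (simp add: mult.assoc[symmetric] monomial.t)
qed (auto intro: monomial.zero)

text \<open>The linear span of the monomials of degree \<open>d = m - n\<close> and length \<open>m + n\<close> at most \<open>N\<close>.\<close>

inductive_set monomial_span :: "nat \<Rightarrow> int \<Rightarrow> 'a set" for N d where
  zero: "0 \<in> monomial_span N d"
| add: "x \<in> monomial_span N d \<Longrightarrow> monomial m n y \<Longrightarrow> m + n \<le> N \<Longrightarrow> int m - int n = d \<Longrightarrow>
    x + scale r y \<in> monomial_span N d"

lemma monomial_span_weaken: "x \<in> monomial_span M d \<Longrightarrow> M \<le> N \<Longrightarrow> x \<in> monomial_span N d"
  by (induction x rule: monomial_span.induct) (auto intro: monomial_span.intros)

lemma monomial_span_t_left:
  assumes "\<alpha> \<in> L" "B \<in> \<I> \<alpha>" "d > 0" "x \<in> monomial_span (Suc N) d"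
  shows "t \<alpha> B * x \<in> monomial_span N (d - 1)"
  using assms(4)
proof (induction x rule: monomial_span.induct)
  case (add x m n y r)
  then obtain m' where "m = Suc m'" using assms(3) by (cases m) auto
  with add assms show ?case
    by (auto simp: distrib_left mult_scale_right intro!: monomial_span.add[where m=m' and n=n] monomial_t_left)
qed (auto intro: monomial_span.zero)

lemma monomial_span_s_right:
  assumes "\<alpha> \<in> L" "B \<in> \<I> \<alpha>" "d < 0" "x \<in> monomial_span (Suc N) d"
  shows "x * s \<alpha> B \<in> monomial_span N (d + 1)"
  using assms(4)
proof (induction x rule: monomial_span.induct)
  case (add x m n y r)
  then obtain n' where "n = Suc n'" using assms(3) by (cases n) auto
  with add assms show ?case
    by (auto simp: distrib_right mult_scale_left intro!: monomial_span.add[where m=m and n=n'] monomial_s_right)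
qed (auto intro: monomial_span.zero)

lemma monomial_0_0: "monomial 0 0 y \<Longrightarrow> \<exists>A. y = p A"
  by (erule monomial.cases) (auto intro: exI[of _ bot] simp: p_bot)

lemma monomial_span_t_s:
  assumes "\<alpha> \<in> L" "B \<in> \<I> \<alpha>" "\<beta> \<in> L" "C \<in> \<I> \<beta>" "x \<in> monomial_span (Suc N) 0"
  shows "t \<alpha> B * x * s \<beta> C \<in> monomial_span N 0"
  using assms(5)
proof (induction x rule: monomial_span.induct)
  case (add x m n y r)
  have eq: "t \<alpha> B * (x + scale r y) * s \<beta> C = t \<alpha> B * x * s \<beta> C + scale r (t \<alpha> B * y * s \<beta> C)"
    by (simp add: distrib_left distrib_right mult_scale_right mult_scale_left)
  show ?case
  proof (cases m)
    case 0
    with add obtain A where "y = p A" using monomial_0_0 by auto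
    then have "t \<alpha> B * y * s \<beta> C = p (\<theta> \<alpha> A) * (t \<alpha> B * s \<beta> C)"
      using assms by (metis mult.assoc t_p)
    also have "\<dots> = (if \<alpha> = \<beta> then p (inf (\<theta> \<alpha> A) (inf B C)) else 0)"
      using assms by (simp add: t_s p_inf)
    finally have "monomial 0 0 (t \<alpha> B * y * s \<beta> C)" by (auto intro: monomial.intros)
    with add.IH show ?thesis unfolding eq by (intro monomial_span.add[where m=0 and n=0]) auto
  next
    case (Suc m')
    then obtain n' where "n = Suc n'" using add by (cases n) auto
    with Suc add assms show ?thesis unfolding eq
      by (intro monomial_span.add[where m=m' and n=n'] monomial_s_right monomial_t_left) auto
  qed
qed (auto intro: monomial_span.zero)

section \<open>Local units\<close>

text \<open>A choice of an element of each ideal $\mathcal I_\alpha$, almost all of them empty. These families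
  are directed under the pointwise order.\<close>

definition finite_family :: "('l \<Rightarrow> 'b) \<Rightarrow> bool" where
  "finite_family C \<longleftrightarrow> (\<forall>\<alpha>\<in>L. C \<alpha> \<in> \<I> \<alpha>) \<and> finite {\<alpha> \<in> L. C \<alpha> \<noteq> bot}"

text \<open>The element $\sum_\alpha s_{\alpha,C_\alpha}s_{\alpha,C_\alpha}^*$. It is an idempotent that
  commutes with every $p_A$, and it is a left unit for any given finite set of monomials that begin with
  a factor $s_{\alpha,B}$, and a right unit for those that end with a factor $s_{\beta,B}^*$, as soon as
  \<open>C\<close> is large enough.\<close>

definition e :: "('l \<Rightarrow> 'b) \<Rightarrow> 'a" where
  "e C = (\<Sum>\<alpha> | \<alpha> \<in> L \<and> C \<alpha> \<noteq> bot. s \<alpha> (C \<alpha>) * t \<alpha> (C \<alpha>))"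

lemma finite_family_bot: "finite_family (\<lambda>_. bot)"
  by (simp add: finite_family_def bot_mem_I)

lemma finite_family_sup: "finite_family C \<Longrightarrow> finite_family D \<Longrightarrow> finite_family (\<lambda>\<alpha>. sup (C \<alpha>) (D \<alpha>))"
  unfolding finite_family_def
  by (auto intro: sup_mem_I rev_finite_subset[of "{\<alpha> \<in> L. C \<alpha> \<noteq> bot} \<union> {\<alpha> \<in> L. D \<alpha> \<noteq> bot}"])

lemma finite_family_single: "\<alpha> \<in> L \<Longrightarrow> B \<in> \<I> \<alpha> \<Longrightarrow> finite_family (\<lambda>\<beta>. if \<beta> = \<alpha> then B else bot)"
  by (auto simp: finite_family_def bot_mem_I)

lemma e_s:
  assumes "finite_family C" "\<alpha> \<in> L" "B \<in> \<I> \<alpha>"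
  shows "e C * s \<alpha> B = s \<alpha> (inf (C \<alpha>) B)"
proof -
  have "e C * s \<alpha> B = (\<Sum>\<beta> | \<beta> \<in> L \<and> C \<beta> \<noteq> bot. if \<beta> = \<alpha> then s \<alpha> (inf (C \<alpha>) B) else 0)"
    unfolding e_def sum_distrib_right
  proof (rule sum.cong[OF refl])
    fix \<beta> assume "\<beta> \<in> {\<beta>. \<beta> \<in> L \<and> C \<beta> \<noteq> bot}"
    with assms show "s \<beta> (C \<beta>) * t \<beta> (C \<beta>) * s \<alpha> B = (if \<beta> = \<alpha> then s \<alpha> (inf (C \<alpha>) B) else 0)"
      by (auto simp: mult.assoc t_s finite_family_def s_inf)
  qed
  also have "\<dots> = s \<alpha> (inf (C \<alpha>) B)"
    using assms by (auto simp: finite_family_def sum.delta s_bot)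
  finally show ?thesis .
qed

lemma t_e:
  assumes "finite_family C" "\<alpha> \<in> L" "B \<in> \<I> \<alpha>"
  shows "t \<alpha> B * e C = t \<alpha> (inf (C \<alpha>) B)"
proof -
  have "t \<alpha> B * e C = (\<Sum>\<beta> | \<beta> \<in> L \<and> C \<beta> \<noteq> bot. if \<beta> = \<alpha> then t \<alpha> (inf (C \<alpha>) B) else 0)"
    unfolding e_def sum_distrib_left
  proof (rule sum.cong[OF refl])
    fix \<beta> assume "\<beta> \<in> {\<beta>. \<beta> \<in> L \<and> C \<beta> \<noteq> bot}"
    with assms show "t \<alpha> B * (s \<beta> (C \<beta>) * t \<beta> (C \<beta>)) = (if \<beta> = \<alpha> then t \<alpha> (inf (C \<alpha>) B) else 0)"
      by (auto simp: mult.assoc[symmetric] t_s finite_family_def t_inf)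
        (metis inf.left_idem inf.commute)
  qed
  also have "\<dots> = t \<alpha> (inf (C \<alpha>) B)"
    using assms by (auto simp: finite_family_def sum.delta t_bot)
  finally show ?thesis .
qed

lemma e_p:
  assumes "finite_family C"
  shows "e C * p A = (\<Sum>\<alpha> | \<alpha> \<in> L \<and> C \<alpha> \<noteq> bot. s \<alpha> (inf (C \<alpha>) (\<theta> \<alpha> A)) * t \<alpha> (inf (C \<alpha>) (\<theta> \<alpha> A)))"
  unfolding e_def sum_distrib_right
proof (rule sum.cong[OF refl])
  fix \<alpha> assume "\<alpha> \<in> {\<alpha>. \<alpha> \<in> L \<and> C \<alpha> \<noteq> bot}"
  then have a: "\<alpha> \<in> L" "C \<alpha> \<in> \<I> \<alpha>" using assms by (auto simp: finite_family_def)
  let ?A = "\<theta> \<alpha> A"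
  have "s \<alpha> (C \<alpha>) * t \<alpha> (C \<alpha>) * p A = s \<alpha> (C \<alpha>) * (p ?A * t \<alpha> (C \<alpha>))"
    using a by (simp add: mult.assoc t_p)
  also have "\<dots> = s \<alpha> (C \<alpha>) * (p ?A * (p ?A * t \<alpha> (C \<alpha>)))"
    by (metis inf.idem mult.assoc p_inf)
  also have "\<dots> = s \<alpha> (inf (C \<alpha>) ?A) * t \<alpha> (inf (C \<alpha>) ?A)"
    using a by (simp add: s_inf' t_inf)
  finally show "s \<alpha> (C \<alpha>) * t \<alpha> (C \<alpha>) * p A = \<dots>" .
qed

lemma e_p_commute:
  assumes "finite_family C"
  shows "e C * p A = p A * e C"
  unfolding e_def sum_distrib_right sum_distrib_left
proof (rule sum.cong[OF refl])
  fix \<alpha> assume "\<alpha> \<in> {\<alpha>. \<alpha> \<in> L \<and> C \<alpha> \<noteq> bot}"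
  then have a: "\<alpha> \<in> L" "C \<alpha> \<in> \<I> \<alpha>" using assms by (auto simp: finite_family_def)
  then show "s \<alpha> (C \<alpha>) * t \<alpha> (C \<alpha>) * p A = p A * (s \<alpha> (C \<alpha>) * t \<alpha> (C \<alpha>))"
    by (simp add: mult.assoc t_p) (simp add: p_s flip: mult.assoc)
qed

lemma e_idem: "finite_family C \<Longrightarrow> e C * e C = e C"
  by (subst (2 3) e_def, unfold sum_distrib_left, rule sum.cong[OF refl])
    (auto simp: mult.assoc[symmetric] e_s finite_family_def)

lemma monomial_left_unit:
  "monomial (Suc m) n y \<Longrightarrow> \<exists>C. finite_family C \<and> (\<forall>D. finite_family D \<and> C \<le> D \<longrightarrow> e D * y = y)"
proof (induction "Suc m" n y rule: monomial.induct)
  case (s n y \<alpha> B)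
  have "e D * (s \<alpha> B * y) = s \<alpha> B * y" if "finite_family D" "(\<lambda>\<beta>. if \<beta> = \<alpha> then B else bot) \<le> D" for D
  proof -
    from that(2) have "B \<le> D \<alpha>" by (auto simp: le_fun_def dest: spec[of _ \<alpha>])
    with that(1) s have "e D * s \<alpha> B = s \<alpha> B" by (simp add: e_s inf_absorb2)
    then show ?thesis by (metis mult.assoc)
  qed
  with s show ?case using finite_family_single by blast
next
  case (t n y \<alpha> B)
  then show ?case by (auto simp flip: mult.assoc)
qed (auto intro: exI[of _ "\<lambda>_. bot"] finite_family_bot)

lemma monomial_right_unit:
  "monomial m (Suc n) y \<Longrightarrow> \<exists>C. finite_family C \<and> (\<forall>D. finite_family D \<and> C \<le> D \<longrightarrow> y * e D = y)"
proof (induction m "Suc n" y rule: monomial.induct)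
  case (t m y \<alpha> B)
  have "(y * t \<alpha> B) * e D = y * t \<alpha> B" if "finite_family D" "(\<lambda>\<beta>. if \<beta> = \<alpha> then B else bot) \<le> D" for D
  proof -
    from that(2) have "B \<le> D \<alpha>" by (auto simp: le_fun_def dest: spec[of _ \<alpha>])
    with that(1) t have "t \<alpha> B * e D = t \<alpha> B" by (simp add: t_e inf_absorb2)
    then show ?thesis by (metis mult.assoc)
  qed
  with t show ?case using finite_family_single by blast
next
  case (s m y \<alpha> B)
  then show ?case by (auto simp: mult.assoc)
qed (auto intro: exI[of _ "\<lambda>_. bot"] finite_family_bot)

lemma monomial_span_left_unit:
  "x \<in> monomial_span N d \<Longrightarrow> d > 0 \<Longrightarrow>
    \<exists>C. finite_family C \<and> (\<forall>D. finite_family D \<and> C \<le> D \<longrightarrow> e D * x = x)"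
proof (induction x rule: monomial_span.induct)
  case (add x m n y r)
  then obtain C1 where C1: "finite_family C1"
    "\<And>D. finite_family D \<Longrightarrow> C1 \<le> D \<Longrightarrow> e D * x = x" by blast
  from add obtain m' where "m = Suc m'" by (cases m) auto
  with add monomial_left_unit obtain C2 where C2: "finite_family C2"
    "\<And>D. finite_family D \<Longrightarrow> C2 \<le> D \<Longrightarrow> e D * y = y" by blast
  show ?case
    by (rule exI[of _ "\<lambda>\<alpha>. sup (C1 \<alpha>) (C2 \<alpha>)"])
      (auto simp: finite_family_sup C1 C2 distrib_left mult_scale_right le_fun_def)
qed (auto intro: exI[of _ "\<lambda>_. bot"] finite_family_bot)

lemma monomial_span_right_unit:
  "x \<in> monomial_span N d \<Longrightarrow> d < 0 \<Longrightarrow>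
    \<exists>C. finite_family C \<and> (\<forall>D. finite_family D \<and> C \<le> D \<longrightarrow> x * e D = x)"
proof (induction x rule: monomial_span.induct)
  case (add x m n y r)
  then obtain C1 where C1: "finite_family C1" "\<And>D. finite_family D \<Longrightarrow> C1 \<le> D \<Longrightarrow> x * e D = x" by blast
  from add obtain n' where "n = Suc n'" by (cases n) auto
  with add monomial_right_unit obtain C2 where C2: "finite_family C2"
    "\<And>D. finite_family D \<Longrightarrow> C2 \<le> D \<Longrightarrow> y * e D = y" by blast
  show ?case
    by (rule exI[of _ "\<lambda>\<alpha>. sup (C1 \<alpha>) (C2 \<alpha>)"])
      (auto simp: finite_family_sup C1 C2 distrib_right mult_scale_left le_fun_def)
qed (auto intro: exI[of _ "\<lambda>_. bot"] finite_family_bot)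

text \<open>The linear span of the elements $p_A$.\<close>

inductive_set p_span :: "'a set" where
  zero: "0 \<in> p_span"
| add: "z \<in> p_span \<Longrightarrow> scale r (p A) + z \<in> p_span"

text \<open>In degree \<open>0\<close> a monomial is either some $p_A$, or begins with an \<open>s\<close> and ends with a \<open>t\<close>;
  the latter monomials have local units on both sides.\<close>

lemma monomial_span_0_decomp:
  "x \<in> monomial_span N 0 \<Longrightarrow>
    \<exists>z w C. x = z + w \<and> z \<in> p_span \<and> finite_family C \<and>
      (\<forall>D. finite_family D \<and> C \<le> D \<longrightarrow> e D * w = w \<and> w * e D = w)"
proof (induction x rule: monomial_span.induct)
  case zero
  show ?case
    by (rule exI[of _ 0], rule exI[of _ 0]) (auto intro: p_span.zero finite_family_bot)
next
  case (add x m n y r)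
  then obtain z w C where x: "x = z + w" "z \<in> p_span" "finite_family C"
    "\<And>D. finite_family D \<Longrightarrow> C \<le> D \<Longrightarrow> e D * w = w \<and> w * e D = w" by blast
  show ?case
  proof (cases m)
    case 0
    with add obtain A where "y = p A" using monomial_0_0 by auto
    with x have "x + scale r y = (scale r (p A) + z) + w" "scale r (p A) + z \<in> p_span"
      by (auto intro: p_span.add)
    with x show ?thesis by blast
  next
    case (Suc m')
    then obtain n' where "n = Suc n'" using add by (cases n) auto
    with Suc add obtain C1 C2 where C12:
      "finite_family C1" "\<And>D. finite_family D \<Longrightarrow> C1 \<le> D \<Longrightarrow> e D * y = y"
      "finite_family C2" "\<And>D. finite_family D \<Longrightarrow> C2 \<le> D \<Longrightarrow> y * e D = y"
      using monomial_left_unit monomial_right_unit by metis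
    let ?C = "\<lambda>\<alpha>. sup (C \<alpha>) (sup (C1 \<alpha>) (C2 \<alpha>))"
    have "e D * (w + scale r y) = w + scale r y \<and> (w + scale r y) * e D = w + scale r y"
      if "finite_family D" "?C \<le> D" for D
      using that x(4)[of D] C12(2,4)[of D]
      by (auto simp: distrib_left distrib_right mult_scale_right mult_scale_left le_fun_def)
    moreover have "x + scale r y = z + (w + scale r y)" using x by (simp add: add.assoc)
    moreover have "finite_family ?C" using x C12 by (intro finite_family_sup)
    ultimately show ?thesis using x(2) by blast
  qed
qed

lemma monomial_span_0_0: "x \<in> monomial_span 0 0 \<Longrightarrow> x \<in> p_span"
proof (induction x rule: monomial_span.induct)
  case (add x m n y r)
  with monomial_0_0 obtain A where "y = p A" by auto
  with add.IH show ?case using p_span.add[of x r A] by (simp add: add.commute)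
qed (rule p_span.zero)

lemma p_span_unit: "z \<in> p_span \<Longrightarrow> \<exists>A. p A * z = z"
proof (induction rule: p_span.induct)
  case (add z r B)
  then obtain A where A: "p A * z = z" by blast
  have "p (sup A B) * z = z"
    by (metis A inf_sup_absorb inf.commute mult.assoc p_inf)
  moreover have "p (sup A B) * p B = p B"
    by (metis inf.commute inf_sup_absorb p_inf sup.commute)
  ultimately show ?case by (intro exI[of _ "sup A B"]) (simp add: distrib_left mult_scale_right)
qed simp

lemma p_span_e: "z \<in> p_span \<Longrightarrow> finite_family C \<Longrightarrow> e C * z = z * e C"
  by (induction rule: p_span.induct)
    (auto simp: distrib_left distrib_right mult_scale_right mult_scale_left e_p_commute)

end

section \<open>Homogeneous elements of a kernel\<close>

text \<open>The properties of the kernel of a homomorphism that does not annihilate any $rp_A$ or $rq_A$ as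
  in the statement of the uniqueness theorem.\<close>

locale gbds_kernel = gbds_representation L \<theta> \<I> \<J> scale p s t
  for L :: "'l set" and \<theta> :: "'l \<Rightarrow> 'b::generalized_boolean_algebra \<Rightarrow> 'b"
    and \<I> :: "'l \<Rightarrow> 'b set" and \<J> :: "'b set"
    and scale :: "'r::{comm_ring, comm_monoid_mult} \<Rightarrow> 'a::ring \<Rightarrow> 'a"
    and p :: "'b \<Rightarrow> 'a" and s t :: "'l \<Rightarrow> 'b \<Rightarrow> 'a" +
  fixes K :: "'a set"
  assumes K_diff: "x \<in> K \<Longrightarrow> y \<in> K \<Longrightarrow> x - y \<in> K"
    and K_p: "x \<in> K \<Longrightarrow> p A * x \<in> K"
    and K_t: "x \<in> K \<Longrightarrow> \<alpha> \<in> L \<Longrightarrow> B \<in> \<I> \<alpha> \<Longrightarrow> t \<alpha> B * x \<in> K"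
    and K_s: "x \<in> K \<Longrightarrow> \<alpha> \<in> L \<Longrightarrow> B \<in> \<I> \<alpha> \<Longrightarrow> x * s \<alpha> B \<in> K"
    and p_notin_K: "r \<noteq> 0 \<Longrightarrow> A \<noteq> bot \<Longrightarrow> scale r (p A) \<notin> K"
    and q_notin_K: "r \<noteq> 0 \<Longrightarrow> A \<in> regular L \<theta> - \<J> \<Longrightarrow> scale r (q A) \<notin> K"
begin

text \<open>If $rp_A - rp_Ae$ lies in \<open>K\<close> and $r\neq0$, then compression by $s_{\alpha,\theta_\alpha(A)}$ gives
  $rp_{\theta_\alpha(A)\setminus C_\alpha}\in K$, whence $\theta_\alpha(A)\subseteq C_\alpha$ for all
  $\alpha$. Hence $p_D - p_De = q_D$ for every $D\subseteq A$. As $q_D = p_D$ when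
  $\Delta_D=\emptyset$, the set \<open>A\<close> is regular, and the assumption on the elements $q_A$ leaves only
  $A\in\mathcal J$, where $q_A=0$.\<close>

lemma K_cut_p:
  assumes C: "finite_family C" and K: "scale r (p A) - scale r (p A) * e C \<in> K"
  shows "scale r (p A) - scale r (p A) * e C = 0"
proof (rule ccontr)
  assume nz: "scale r (p A) - scale r (p A) * e C \<noteq> 0"
  then have r: "r \<noteq> 0" by (auto simp: scale_zero_left)
  have below: "scale r (p D) - scale r (p D) * e C \<in> K" if "D \<le> A" for D
  proof -
    have "p D * p A = p D" using that by (metis inf_absorb1 p_inf)
    then have "p D * (scale r (p A) - scale r (p A) * e C) = scale r (p D) - scale r (p D) * e C"
      by (simp add: right_diff_distrib mult_scale_left mult_scale_right flip: mult.assoc)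
    with K_p[OF K, of D] show ?thesis by simp
  qed
  have le: "\<theta> \<alpha> A \<le> C \<alpha>" if a: "\<alpha> \<in> L" for \<alpha>
  proof -
    let ?B = "\<theta> \<alpha> A"
    have B: "?B \<in> \<I> \<alpha>" using a by (rule theta_mem_I)
    have CI: "C \<alpha> \<in> \<I> \<alpha>" using C a by (auto simp: finite_family_def)
    have "p A * s \<alpha> ?B = s \<alpha> ?B" using a B by (simp add: p_s s_p_self)
    then have ts: "t \<alpha> ?B * p A * s \<alpha> ?B = p ?B"
      using a B by (simp add: mult.assoc t_s)
    have "t \<alpha> ?B * (p A * e C) * s \<alpha> ?B = (p ?B * t \<alpha> ?B) * (e C * s \<alpha> ?B)"
      using a B by (metis mult.assoc t_p)
    also have "\<dots> = p (inf ?B (C \<alpha>))"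
      using a B C CI inf_mem_I[OF a CI, of ?B]
      by (simp add: p_t_self e_s t_s inf.left_commute inf.commute)
    finally have tes: "t \<alpha> ?B * (p A * e C) * s \<alpha> ?B = p (inf ?B (C \<alpha>))" .
    have "t \<alpha> ?B * (scale r (p A) - scale r (p A) * e C) * s \<alpha> ?B
        = scale r (t \<alpha> ?B * p A * s \<alpha> ?B) - scale r (t \<alpha> ?B * (p A * e C) * s \<alpha> ?B)"
      by (simp add: right_diff_distrib left_diff_distrib mult_scale_left mult_scale_right)
    also have "\<dots> = scale r (p (?B - C \<alpha>))"
      unfolding ts tes using p_split[of ?B "C \<alpha>"] by (simp flip: scale_diff_right)
    finally have "scale r (p (?B - C \<alpha>)) \<in> K"
      using K_s[OF K_t[OF K a B] a B] by simp
    with p_notin_K[OF r] have "?B - C \<alpha> = bot" by blast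
    then show ?thesis by (rule diff_eq_bot_imp_le)
  qed
  have q: "scale r (p D) - scale r (p D) * e C = scale r (q D)" and fin: "finite (Delta L \<theta> D)"
    if "D \<le> A" for D
  proof -
    have leD: "\<theta> \<alpha> D \<le> C \<alpha>" if "\<alpha> \<in> L" for \<alpha>
      using le[OF that] theta_mono[OF that \<open>D \<le> A\<close>] by (rule order_trans[rotated])
    have sub: "Delta L \<theta> D \<subseteq> {\<alpha> \<in> L. C \<alpha> \<noteq> bot}"
      using leD by (auto simp: Delta_def) (metis bot.extremum_uniqueI)
    moreover have finC: "finite {\<alpha> \<in> L. C \<alpha> \<noteq> bot}" using C by (simp add: finite_family_def)
    ultimately show "finite (Delta L \<theta> D)" by (rule finite_subset)
    have "p D * e C = (\<Sum>\<alpha> | \<alpha> \<in> L \<and> C \<alpha> \<noteq> bot. s \<alpha> (\<theta> \<alpha> D) * t \<alpha> (\<theta> \<alpha> D))"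
      unfolding e_p_commute[OF C, symmetric] e_p[OF C]
      by (rule sum.cong) (auto simp: inf_absorb2 leD)
    also have "\<dots> = (\<Sum>\<alpha> \<in> Delta L \<theta> D. s \<alpha> (\<theta> \<alpha> D) * t \<alpha> (\<theta> \<alpha> D))"
      using sub finC by (intro sum.mono_neutral_right) (auto simp: Delta_def s_bot)
    finally show "scale r (p D) - scale r (p D) * e C = scale r (q D)"
      by (simp add: q_def scale_diff_right mult_scale_left)
  qed
  have "Delta L \<theta> D \<noteq> {}" if "D \<noteq> bot" "D \<le> A" for D
  proof
    assume "Delta L \<theta> D = {}"
    then have "q D = p D" by (simp add: q_def)
    with below[OF that(2)] q[OF that(2)] p_notin_K[OF r that(1)] show False by simp
  qed
  with fin have "A \<in> regular L \<theta>" by (auto simp: regular_def)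
  moreover have "A \<notin> \<J>"
  proof
    assume "A \<in> \<J>"
    then have "q A = 0" using p_sum[of A] by (simp add: q_def)
    with nz q[of A] show False by (simp add: scale_zero_right)
  qed
  ultimately show False using q_notin_K[OF r, of A] K q[of A] by simp
qed

text \<open>The extra summand $rp_A$ makes the induction on the number of terms work: the term $r'p_B$ is
  absorbed by splitting \<open>A\<close> into \<open>inf A B\<close> and \<open>A - B\<close>.\<close>

lemma K_cut_p_span:
  assumes C: "finite_family C" and z: "z \<in> p_span"
  shows "x = scale r (p A) + p A * z \<Longrightarrow> x - x * e C \<in> K \<Longrightarrow> x - x * e C = 0"
  using z
proof (induction arbitrary: r A x rule: p_span.induct)
  case zero
  then show ?case using K_cut_p[OF C, of r A] by simp
next
  case (add z r' B)
  let ?x1 = "scale (r + r') (p (inf A B)) + p (inf A B) * z"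
  let ?x2 = "scale r (p (A - B)) + p (A - B) * z"
  have AB: "p (A - B) * p B = 0" by (metis inf.commute inf_relcomp p_bot p_inf)
  have x: "x = ?x1 + ?x2"
  proof -
    have "x = scale r (p A) + scale r' (p (inf A B)) + p A * z"
      unfolding add.prems by (simp add: distrib_left mult_scale_right p_inf add.assoc)
    then show ?thesis
      unfolding p_split[of A B] scale_right_distrib scale_left_distrib distrib_right
      by (simp add: add_ac)
  qed
  have 1: "p B * ?x1 = ?x1"
    by (simp add: distrib_left mult_scale_right mult.assoc[symmetric] p_inf[symmetric]
        inf_absorb2)
  have 2: "p B * ?x2 = 0"
    by (simp add: distrib_left mult_scale_right mult.assoc[symmetric] p_inf[symmetric]
        inf_relcomp p_bot scale_zero_right)
  have Bx: "p B * x = ?x1" unfolding x by (subst distrib_left) (simp only: 1 2 add_0_right)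
  have "p B * (x - x * e C) = ?x1 - ?x1 * e C"
    by (simp only: right_diff_distrib mult.assoc[symmetric] Bx)
  with K_p[OF add.prems(2), of B] have K1: "?x1 - ?x1 * e C \<in> K" by simp
  have split: "x - x * e C = (?x1 - ?x1 * e C) + (?x2 - ?x2 * e C)"
    unfolding x distrib_right[of ?x1 ?x2] by (rule add_diff_add)
  with K_diff[OF add.prems(2) K1] have K2: "?x2 - ?x2 * e C \<in> K" by simp
  show ?case
    unfolding split add.IH[OF refl K1] add.IH[OF refl K2] by simp
qed

text \<open>Induction on the length of the monomials. In degree $d>0$ all monomials begin with a factor \<open>s\<close>;
  the elements $s_{\alpha,B}^*x$ lie in \<open>K\<close> and have shorter monomials, so they vanish, and $x = ex = 0$
  for a suitable local unit \<open>e\<close>. Degree $d<0$ is symmetric. In degree \<open>0\<close> write $x=z+w$ with \<open>z\<close> in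
  the span of the $p_A$ and $w=ew=we$; the induction hypothesis gives $exe=0$, which amounts to
  $w=-ze$, so that $x=z-ze$.\<close>

lemma homogeneous_kernel:
  "x \<in> monomial_span N d \<Longrightarrow> x \<in> K \<Longrightarrow> x = 0"
proof (induction N arbitrary: d x rule: less_induct)
  case (less N)
  have sum_zero: "e C * y = 0" if "finite_family C" "\<And>\<alpha>. \<alpha> \<in> L \<Longrightarrow> t \<alpha> (C \<alpha>) * y = 0" for C y
    unfolding e_def sum_distrib_right using that by (auto simp: mult.assoc intro!: sum.neutral)
  have zero_sum: "y * e C = 0" if "finite_family C" "\<And>\<alpha>. \<alpha> \<in> L \<Longrightarrow> y * s \<alpha> (C \<alpha>) = 0" for C y
    unfolding e_def sum_distrib_left using that by (auto simp: mult.assoc[symmetric] intro!: sum.neutral)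
  consider "d > 0" | "d < 0" | "d = 0" by linarith
  then show ?case
  proof cases
    case 1
    then obtain C where C: "finite_family C" "e C * x = x"
      using monomial_span_left_unit[OF less.prems(1)] by blast
    show ?thesis
    proof (cases N)
      case 0
      with 1 less.prems(1) show ?thesis by (auto elim: monomial_span.cases)
    next
      case (Suc M)
      have "t \<alpha> (C \<alpha>) * x = 0" if "\<alpha> \<in> L" for \<alpha>
        using that C(1) 1 Suc less
        by (intro less.IH[of M _ "d - 1"])
          (auto simp: finite_family_def intro: monomial_span_t_left K_t)
      with sum_zero C show ?thesis by metis
    qed
  next
    case 2
    then obtain C where C: "finite_family C" "x * e C = x"
      using monomial_span_right_unit[OF less.prems(1)] by blast
    show ?thesis
    proof (cases N)
      case 0
      with 2 less.prems(1) show ?thesis by (auto elim: monomial_span.cases)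
    next
      case (Suc M)
      have "x * s \<alpha> (C \<alpha>) = 0" if "\<alpha> \<in> L" for \<alpha>
        using that C(1) 2 Suc less
        by (intro less.IH[of M _ "d + 1"])
          (auto simp: finite_family_def intro: monomial_span_s_right K_s)
      with zero_sum C show ?thesis by metis
    qed
  next
    case 3
    have "\<exists>z C. z \<in> p_span \<and> finite_family C \<and> x = z - z * e C"
    proof (cases N)
      case 0
      from less.prems(1) have "x \<in> p_span" unfolding 0 3 by (rule monomial_span_0_0)
      moreover have "e (\<lambda>_. bot) = 0" by (simp add: e_def)
      ultimately show ?thesis using finite_family_bot by (intro exI[of _ x] exI[of _ "\<lambda>_. bot"]) simp
    next
      case (Suc M)
      obtain z w C where x: "x = z + w" "z \<in> p_span" "finite_family C" "e C * w = w" "w * e C = w"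
        using monomial_span_0_decomp less.prems(1) 3 by blast
      have "t \<alpha> (C \<alpha>) * x * s \<beta> (C \<beta>) = 0" if "\<alpha> \<in> L" "\<beta> \<in> L" for \<alpha> \<beta>
        using that x(3) 3 Suc less
        by (intro less.IH[of M _ 0] monomial_span_t_s K_s[OF K_t]) (auto simp: finite_family_def)
      then have "e C * (x * e C) = 0"
        using x(3) by (intro sum_zero) (auto simp: mult.assoc[symmetric] intro: zero_sum)
      moreover have "e C * (x * e C) = z * e C + w"
      proof -
        have "e C * (z * e C) = z * e C"
          using p_span_e[OF x(2,3)] e_idem[OF x(3)] by (metis mult.assoc)
        with x show ?thesis by (simp add: distrib_left distrib_right)
      qed
      ultimately have "w = - (z * e C)" by (simp add: eq_neg_iff_add_eq_0 add.commute)
      with x show ?thesis by (intro exI[of _ z] exI[of _ C]) simp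
    qed
    then obtain z C where z: "z \<in> p_span" and C: "finite_family C" "x = z - z * e C" by blast
    obtain A where "p A * z = z" using p_span_unit z by blast
    then have "z = scale 0 (p A) + p A * z" by (simp add: scale_zero_left)
    from K_cut_p_span[OF C(1) z this] less.prems(2) C(2) show ?thesis by simp
  qed
qed

end

section \<open>Presented algebras as a ring type\<close>

lemma free_algebra_zero: "0 \<in> free_algebra X"
  by (simp add: free_algebra_def)

lemma free_algebra_uminus: "x \<in> free_algebra X \<Longrightarrow> - x \<in> free_algebra X"
  using free_algebra_scale[of x X "- 1"] by (simp add: nc_scale_minus_one)

lemma free_algebra_diff: "x \<in> free_algebra X \<Longrightarrow> y \<in> free_algebra X \<Longrightarrow> x - y \<in> free_algebra X"
  using free_algebra_add[of x X "- y"] free_algebra_uminus[of y X] by simp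

lemma free_algebra_sum: "(\<And>i. i \<in> I \<Longrightarrow> x i \<in> free_algebra X) \<Longrightarrow> sum x I \<in> free_algebra X"
  by (induction I rule: infinite_finite_induct) (auto intro: free_algebra_zero free_algebra_add)

lemma free_algebra_gen: "g \<in> X \<Longrightarrow> nc_gen g \<in> free_algebra X"
  by (auto simp: free_algebra_def nc_gen_def)

lemma nc_scale_single: "nc_scale r (Poly_Mapping.single w c) = Poly_Mapping.single w (r * c)"
  by (rule poly_mapping_eqI) (simp add: nc_scale_lookup lookup_single when_def)

lemma nc_scale_add: "nc_scale r (x + y) = nc_scale r x + nc_scale r y"
  by (rule poly_mapping_eqI) (simp add: nc_scale_lookup lookup_add distrib_left)

lemma nc_scale_zero: "nc_scale r 0 = 0"
  by (rule poly_mapping_eqI) (simp add: nc_scale_lookup)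

lemma nc_poly_as_sum: "x = (\<Sum>w \<in> Poly_Mapping.keys x. Poly_Mapping.single w (Poly_Mapping.lookup x w))"
  by (rule poly_mapping_eqI)
    (simp add: lookup_sum lookup_single when_def in_keys_iff sum.delta)

lemma nc_poly_induct [case_names single add]:
  fixes x :: "('g, 'r::{comm_ring, comm_monoid_mult}) nc_poly"
  assumes "\<And>w c. P (Poly_Mapping.single w c)" "\<And>x y. P x \<Longrightarrow> P y \<Longrightarrow> P (x + y)"
  shows "P x"
proof -
  have "P (\<Sum>w \<in> W. Poly_Mapping.single w (Poly_Mapping.lookup x w))" for W
    by (induction W rule: infinite_finite_induct)
      (use assms(1)[of _ 0] in \<open>auto intro: assms(1,2)\<close>)
  then show ?thesis using nc_poly_as_sum[of x] by metis
qed

lemma nc_scale_mult_left: "nc_scale r x * y = nc_scale r (x * y)"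
proof (induction x rule: nc_poly_induct)
  case (single u c)
  show ?case
    by (induction y rule: nc_poly_induct)
      (simp_all add: nc_scale_single mult_single nc_scale_add distrib_left mult.assoc)
qed (simp add: nc_scale_add distrib_right)

lemma nc_scale_mult_right: "x * nc_scale r y = nc_scale r (x * y)"
proof (induction x rule: nc_poly_induct)
  case (single u c)
  show ?case
    by (induction y rule: nc_poly_induct)
      (simp_all add: nc_scale_single mult_single nc_scale_add distrib_left mult.left_commute)
qed (simp add: nc_scale_add distrib_right)

lemma generated_ideal_sym:
  "x - y \<in> generated_ideal X E \<Longrightarrow> y - x \<in> generated_ideal X E"
  using generated_ideal_uminus[of "x - y" X E] by simp

lemma generated_ideal_trans:
  "x - y \<in> generated_ideal X E \<Longrightarrow> y - z \<in> generated_ideal X E \<Longrightarrow> x - z \<in> generated_ideal X E"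
  using generated_ideal.add[of "x - y" X E "y - z"] by simp

lemma generated_ideal_mult_cong:
  assumes "x - x' \<in> generated_ideal X E" "y - y' \<in> generated_ideal X E"
    and "y \<in> free_algebra X" "x' \<in> free_algebra X"
  shows "x * y - x' * y' \<in> generated_ideal X E"
proof -
  have "x * y - x' * y' = (x - x') * y + x' * (y - y')" by (simp add: algebra_simps)
  with assms show ?thesis
    by (auto intro: generated_ideal.add generated_ideal.mult_left generated_ideal.mult_right)
qed

text \<open>The index set below consists of all presentations, that is, of all pairs of a
  set \<open>X\<close> of generators and a set \<open>E\<close> of equations. A family of noncommutative polynomials stands
  for an element of the direct product of the algebras so presented when its member at \<open>(X, E)\<close>
  is a polynomial in \<open>X\<close> without constant term; two families stand for the same element when they
  agree modulo each of the ideals.\<close>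

definition presented_rel where
  "presented_rel h k \<longleftrightarrow> (\<forall>X E. h (X, E) \<in> free_algebra X \<and> k (X, E) \<in> free_algebra X \<and>
     h (X, E) - k (X, E) \<in> generated_ideal X E)"

lemma part_equivp_presented_rel: "part_equivp presented_rel"
proof (rule part_equivpI)
  show "\<exists>h. presented_rel h h"
    by (rule exI[of _ "\<lambda>_. 0"]) (simp add: presented_rel_def free_algebra_zero generated_ideal.zero)
  show "symp presented_rel"
    by (auto simp: presented_rel_def symp_def intro: generated_ideal_sym)
  show "transp presented_rel"
    unfolding presented_rel_def transp_def using generated_ideal_trans by blast
qed

text \<open>Polynomials stay atomic when operations are lifted to the quotient.\<close>

lifting_forget poly_mapping.lifting

text \<open>A single algebra presented by \<open>X\<close> and \<open>E\<close> depends on these parameters and is not a type.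
  The product of all of them is one, and each presented algebra is a direct factor of it. Calculations
  in $L_R(\mathcal B,\mathcal L,\theta,\mathcal I,\mathcal J)$ thereby become equations in a type of
  class \<^class>\<open>ring\<close>.\<close>

quotient_type (overloaded) ('g, 'r) presented =
    "'g set \<times> (('g, 'r::{comm_ring, comm_monoid_mult}) nc_poly \<times> ('g, 'r) nc_poly) set \<Rightarrow> ('g, 'r) nc_poly" /
    partial: presented_rel
  by (rule part_equivp_presented_rel)

instantiation presented :: (type, "{comm_ring, comm_monoid_mult}") ring
begin

lift_definition zero_presented :: "('a, 'b) presented" is "\<lambda>_. 0"
  by (simp add: presented_rel_def free_algebra_zero generated_ideal.zero)

lift_definition plus_presented :: "('a, 'b) presented \<Rightarrow> ('a, 'b) presented \<Rightarrow> ('a, 'b) presented"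
  is "\<lambda>h k i. h i + k i"
  by (auto simp: presented_rel_def free_algebra_add add_diff_add intro: generated_ideal.add)

lift_definition uminus_presented :: "('a, 'b) presented \<Rightarrow> ('a, 'b) presented"
  is "\<lambda>h i. - h i"
  by (simp add: presented_rel_def free_algebra_uminus minus_diff_minus generated_ideal_uminus
      del: diff_minus_eq_add minus_diff_eq)

lift_definition minus_presented :: "('a, 'b) presented \<Rightarrow> ('a, 'b) presented \<Rightarrow> ('a, 'b) presented"
  is "\<lambda>h k i. h i - k i"
proof -
  fix h h' k k' :: "'a set \<times> (('a, 'b) nc_poly \<times> ('a, 'b) nc_poly) set \<Rightarrow> ('a, 'b) nc_poly"
  assume a: "presented_rel h h'" "presented_rel k k'"
  have "h (X, E) - k (X, E) - (h' (X, E) - k' (X, E)) \<in> generated_ideal X E" for X E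
  proof -
    have "h (X, E) - k (X, E) - (h' (X, E) - k' (X, E))
        = (h (X, E) - h' (X, E)) + (k' (X, E) - k (X, E))" by simp
    moreover have "h (X, E) - h' (X, E) \<in> generated_ideal X E" "k' (X, E) - k (X, E) \<in> generated_ideal X E"
      using a by (auto simp: presented_rel_def intro: generated_ideal_sym[of "k (X, E)"])
    ultimately show ?thesis by (metis generated_ideal.add)
  qed
  with a show "presented_rel (\<lambda>i. h i - k i) (\<lambda>i. h' i - k' i)"
    by (simp add: presented_rel_def free_algebra_diff)
qed

lift_definition times_presented :: "('a, 'b) presented \<Rightarrow> ('a, 'b) presented \<Rightarrow> ('a, 'b) presented"
  is "\<lambda>h k i. h i * k i"
  by (simp add: presented_rel_def free_algebra_mult generated_ideal_mult_cong)

instance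
  by standard (transfer; simp add: presented_rel_def algebra_simps free_algebra_zero generated_ideal.zero
      free_algebra_add free_algebra_mult free_algebra_uminus free_algebra_diff)+

end

lift_definition presented_scale ::
    "'r::{comm_ring, comm_monoid_mult} \<Rightarrow> ('g, 'r) presented \<Rightarrow> ('g, 'r) presented"
  is "\<lambda>r h i. nc_scale r (h i)"
  by (auto simp: presented_rel_def free_algebra_scale simp flip: nc_scale_diff intro: generated_ideal.scale)

text \<open>The embedding \<open>presented_of X E\<close> sends a polynomial over \<open>X\<close> to its class in the factor at \<open>(X, E)\<close>; all
  other coordinates are \<open>0\<close>. It is additive and multiplicative on \<open>free_algebra X\<close>, and its kernel
  there is the ideal generated by the equations.\<close>

lift_definition presented_of ::
    "'g set \<Rightarrow> (('g, 'r::{comm_ring, comm_monoid_mult}) nc_poly \<times> ('g, 'r) nc_poly) set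
      \<Rightarrow> ('g, 'r) nc_poly \<Rightarrow> ('g, 'r) presented"
  is "\<lambda>X E x i. if i = (X, E) \<and> x \<in> free_algebra X then x else 0"
  by (simp add: presented_rel_def free_algebra_zero generated_ideal.zero)

lemma presented_rel_refl: "(\<And>X E. h (X, E) \<in> free_algebra X) \<Longrightarrow> h = k \<Longrightarrow> presented_rel h k"
  by (auto simp: presented_rel_def generated_ideal.zero)

interpretation presented: r_algebra presented_scale
proof
  fix r r' :: "'r::{comm_ring, comm_monoid_mult}" and a b :: "('g, 'r) presented"
  show "presented_scale r (a + b) = presented_scale r a + presented_scale r b"
    by transfer (rule presented_rel_refl, auto simp: presented_rel_def nc_scale_add free_algebra_scale free_algebra_add)
  show "presented_scale (r + r') a = presented_scale r a + presented_scale r' a"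
    by transfer (rule presented_rel_refl, auto simp: presented_rel_def free_algebra_scale free_algebra_add
        intro!: poly_mapping_eqI simp: nc_scale_lookup lookup_add distrib_right)
  show "presented_scale r (presented_scale r' a) = presented_scale (r * r') a"
    by transfer (rule presented_rel_refl, auto simp: presented_rel_def free_algebra_scale
        intro!: poly_mapping_eqI simp: nc_scale_lookup mult.assoc)
  show "presented_scale 1 a = a"
    by transfer (rule presented_rel_refl, auto simp: presented_rel_def free_algebra_scale
        intro!: poly_mapping_eqI simp: nc_scale_lookup)
  show "presented_scale r a * b = presented_scale r (a * b)"
    by transfer (rule presented_rel_refl, auto simp: presented_rel_def free_algebra_scale free_algebra_mult nc_scale_mult_left)
  show "a * presented_scale r b = presented_scale r (a * b)"
    by transfer (rule presented_rel_refl, auto simp: presented_rel_def free_algebra_scale free_algebra_mult nc_scale_mult_right)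
qed

lemma presented_of_add:
  "x \<in> free_algebra X \<Longrightarrow> y \<in> free_algebra X \<Longrightarrow>
    presented_of X E (x + y) = presented_of X E x + presented_of X E y"
  by transfer (rule presented_rel_refl, auto simp: free_algebra_zero free_algebra_add)

lemma presented_of_diff:
  "x \<in> free_algebra X \<Longrightarrow> y \<in> free_algebra X \<Longrightarrow>
    presented_of X E (x - y) = presented_of X E x - presented_of X E y"
  by transfer (rule presented_rel_refl, auto simp: free_algebra_zero free_algebra_diff)

lemma presented_of_mult:
  "x \<in> free_algebra X \<Longrightarrow> y \<in> free_algebra X \<Longrightarrow>
    presented_of X E (x * y) = presented_of X E x * presented_of X E y"
  by transfer (rule presented_rel_refl, auto simp: free_algebra_zero free_algebra_mult)

lemma presented_of_scale:
  "x \<in> free_algebra X \<Longrightarrow> presented_of X E (nc_scale r x) = presented_scale r (presented_of X E x)"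
  by transfer (rule presented_rel_refl, auto simp: free_algebra_zero free_algebra_scale nc_scale_zero)

lemma presented_of_zero: "presented_of X E 0 = 0"
  by transfer (rule presented_rel_refl, auto simp: free_algebra_zero)

lemma presented_of_sum:
  "(\<And>i. i \<in> I \<Longrightarrow> x i \<in> free_algebra X) \<Longrightarrow>
    presented_of X E (sum x I) = (\<Sum>i\<in>I. presented_of X E (x i))"
  by (induction I rule: infinite_finite_induct)
    (auto simp: presented_of_zero presented_of_add free_algebra_sum)

lemma presented_of_eq_iff:
  "x \<in> free_algebra X \<Longrightarrow> y \<in> free_algebra X \<Longrightarrow>
    presented_of X E x = presented_of X E y \<longleftrightarrow> x - y \<in> generated_ideal X E"
  by transfer (auto simp: presented_rel_def free_algebra_zero generated_ideal.zero)

section \<open>The universal representation\<close>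

context relative_gbds
begin

abbreviation gens :: "('b, 'l) gbds_gen set" where
  "gens \<equiv> gbds_gens L \<I>"

abbreviation rels :: "(('b, 'l, 'r::{comm_ring, comm_monoid_mult}) gbds_poly \<times> ('b, 'l, 'r) gbds_poly) set" where
  "rels \<equiv> gbds_relations L \<theta> \<I> \<J>"

text \<open>The class of a polynomial in
  $L_R(\mathcal B,\mathcal L,\theta,\mathcal I,\mathcal J)$, as an element of the ring type.\<close>

abbreviation cls :: "('b, 'l, 'r::{comm_ring, comm_monoid_mult}) gbds_poly \<Rightarrow> (('b, 'l) gbds_gen, 'r) presented" where
  "cls \<equiv> presented_of gens rels"

lemma gens_free_algebra:
  "polyP A \<in> free_algebra gens"
  "\<alpha> \<in> L \<Longrightarrow> B \<in> \<I> \<alpha> \<Longrightarrow> polyS \<alpha> B \<in> free_algebra gens"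
  "\<alpha> \<in> L \<Longrightarrow> B \<in> \<I> \<alpha> \<Longrightarrow> polyT \<alpha> B \<in> free_algebra gens"
  by (auto intro!: free_algebra_gen simp: gbds_gens_def)

lemma relations_free_algebra:
  "(x, y) \<in> rels \<Longrightarrow> x \<in> free_algebra gens \<and> y \<in> free_algebra gens"
  by (induction rule: gbds_relations.cases)
    (auto simp: Delta_def intro!: free_algebra_zero free_algebra_add free_algebra_diff free_algebra_mult
      free_algebra_sum gens_free_algebra inf_mem_I theta_mem_I)

lemma cls_rel: "(x, y) \<in> rels \<Longrightarrow> cls x = cls y"
  using relations_free_algebra[of x y] generated_ideal.relator[of x y rels gens]
  by (simp add: presented_of_eq_iff)

lemmas free_algebra_rules = free_algebra_zero free_algebra_add free_algebra_diff free_algebra_mult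
  free_algebra_sum gens_free_algebra theta_mem_I

lemma pq_free_algebra:
  "polyP A \<in> free_algebra gens"
  "polyP A - (\<Sum>\<alpha> \<in> Delta L \<theta> A. polyS \<alpha> (\<theta> \<alpha> A) * polyT \<alpha> (\<theta> \<alpha> A)) \<in> free_algebra gens"
  by (auto simp: Delta_def intro!: free_algebra_rules)

lemma cls_monomials:
  "cls (polyP A * polyP A') = cls (polyP A) * (cls (polyP A') :: (_, 'r::{comm_ring, comm_monoid_mult}) presented)"
    "\<alpha> \<in> L \<Longrightarrow> B \<in> \<I> \<alpha> \<Longrightarrow> cls (polyP A * polyS \<alpha> B) = cls (polyP A) * (cls (polyS \<alpha> B) :: (_, 'r) presented)"
    "\<alpha> \<in> L \<Longrightarrow> B \<in> \<I> \<alpha> \<Longrightarrow> cls (polyS \<alpha> B * polyP A) = cls (polyS \<alpha> B) * (cls (polyP A) :: (_, 'r) presented)"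
    "\<alpha> \<in> L \<Longrightarrow> B \<in> \<I> \<alpha> \<Longrightarrow> cls (polyP A * polyT \<alpha> B) = cls (polyP A) * (cls (polyT \<alpha> B) :: (_, 'r) presented)"
    "\<alpha> \<in> L \<Longrightarrow> B \<in> \<I> \<alpha> \<Longrightarrow> cls (polyT \<alpha> B * polyP A) = cls (polyT \<alpha> B) * (cls (polyP A) :: (_, 'r) presented)"
    "\<alpha> \<in> L \<Longrightarrow> B \<in> \<I> \<alpha> \<Longrightarrow> \<beta> \<in> L \<Longrightarrow> C \<in> \<I> \<beta> \<Longrightarrow>
      cls (polyT \<alpha> B * polyS \<beta> C) = cls (polyT \<alpha> B) * (cls (polyS \<beta> C) :: (_, 'r) presented)"
    "\<alpha> \<in> L \<Longrightarrow> B \<in> \<I> \<alpha> \<Longrightarrow> \<beta> \<in> L \<Longrightarrow> C \<in> \<I> \<beta> \<Longrightarrow>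
      cls (polyS \<alpha> B * polyT \<beta> C) = cls (polyS \<alpha> B) * (cls (polyT \<beta> C) :: (_, 'r) presented)"
  by (simp_all add: presented_of_mult gens_free_algebra)

lemma cls_sum_st:
  "cls (\<Sum>\<alpha> \<in> Delta L \<theta> A. polyS \<alpha> (\<theta> \<alpha> A) * polyT \<alpha> (\<theta> \<alpha> A)) =
    (\<Sum>\<alpha> \<in> Delta L \<theta> A. cls (polyS \<alpha> (\<theta> \<alpha> A)) * cls (polyT \<alpha> (\<theta> \<alpha> A)))"
  by (subst presented_of_sum)
    (auto simp: Delta_def cls_monomials theta_mem_I intro!: free_algebra_rules sum.cong)

text \<open>The classes of the generators form a representation, whose linear span of monomials is the
  whole algebra.\<close>

sublocale univ: gbds_representation L \<theta> \<I> \<J> presented_scale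
  "\<lambda>A. cls (polyP A)" "\<lambda>\<alpha> B. cls (polyS \<alpha> B)" "\<lambda>\<alpha> B. cls (polyT \<alpha> B)"
proof (unfold_locales, goal_cases)
  case 1
  then show ?case using cls_rel[OF gbds_relations.P_bot] by (simp add: presented_of_zero)
next
  case (2 A A')
  then show ?case using cls_rel[OF gbds_relations.P_inf] by (simp add: cls_monomials)
next
  case (3 A A')
  then show ?case using cls_rel[OF gbds_relations.P_sup]
    by (simp add: presented_of_add presented_of_diff free_algebra_rules)
next
  case (4 \<alpha> B A)
  then show ?case using cls_rel[OF gbds_relations.P_S, of \<alpha> B] by (simp add: cls_monomials)
next
  case (5 \<alpha> B A)
  then show ?case using cls_rel[OF gbds_relations.T_P, of \<alpha> B] by (simp add: cls_monomials)
next
  case (6 \<alpha> B \<alpha>' B')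
  then show ?case using cls_rel[OF gbds_relations.T_S, of \<alpha> B \<alpha>' B']
    by (auto simp add: cls_monomials presented_of_zero)
next
  case (7 \<alpha> B B')
  then show ?case using cls_rel[OF gbds_relations.S_inf, of \<alpha> B] by (simp add: cls_monomials)
next
  case (8 \<alpha> B B')
  then show ?case using cls_rel[OF gbds_relations.T_inf, of \<alpha> B] by (simp add: cls_monomials)
next
  case (9 A)
  then show ?case using cls_rel[OF gbds_relations.P_sum, of A] by (simp add: cls_sum_st)
qed

text \<open>By induction on the word, each letter being multiplied from the left to a monomial.\<close>

lemma cls_word:
  assumes "letters w \<noteq> []" "set (letters w) \<subseteq> gens"
  shows "\<exists>m n. int m - int n = word_degree w \<and>
    univ.monomial m n (cls (Poly_Mapping.single w (1::'r::{comm_ring, comm_monoid_mult})))"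
proof -
  have "\<exists>m n. int m - int n = word_degree (Word gs) \<and>
      univ.monomial m n (cls (Poly_Mapping.single (Word gs) (1::'r)))"
    if "gs \<noteq> []" "set gs \<subseteq> gens" for gs
    using that
  proof (induction gs rule: list_nonempty_induct)
    case (single g)
    have gen: "Poly_Mapping.single (Word [g]) (1::'r) = nc_gen g" by (simp add: nc_gen_def)
    show ?case unfolding gen
    proof (cases g)
      case (GenP A)
      then show "\<exists>m n. int m - int n = word_degree (Word [g]) \<and> univ.monomial m n (cls (nc_gen g :: (_, 'r) nc_poly))"
        using univ.monomial.p by (intro exI[of _ 0]) (auto simp: word_degree_def)
    next
      case (GenS \<alpha> B)
      with single have a: "\<alpha> \<in> L" "B \<in> \<I> \<alpha>" by (auto simp: gbds_gens_def)
      have "univ.monomial 1 0 (cls (nc_gen g :: (_, 'r) nc_poly))"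
        using univ.monomial.s[OF univ.monomial.p a, of B] GenS by (simp add: univ.s_p_self[OF a])
      with GenS show "\<exists>m n. int m - int n = word_degree (Word [g]) \<and> univ.monomial m n (cls (nc_gen g :: (_, 'r) nc_poly))"
        by (intro exI[of _ 1] exI[of _ 0]) (auto simp: word_degree_def)
    next
      case (GenT \<alpha> B)
      with single have a: "\<alpha> \<in> L" "B \<in> \<I> \<alpha>" by (auto simp: gbds_gens_def)
      have "univ.monomial 0 1 (cls (nc_gen g :: (_, 'r) nc_poly))"
        using univ.monomial.t[OF univ.monomial.p a, of B] GenT by (simp add: univ.p_t_self[OF a])
      with GenT show "\<exists>m n. int m - int n = word_degree (Word [g]) \<and> univ.monomial m n (cls (nc_gen g :: (_, 'r) nc_poly))"
        by (intro exI[of _ 0] exI[of _ 1]) (auto simp: word_degree_def)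
    qed
  next
    case (cons g gs)
    let ?y = "cls (Poly_Mapping.single (Word gs) (1::'r))"
    from cons obtain m n where mn: "int m - int n = word_degree (Word gs)" "univ.monomial m n ?y" by auto
    have g: "g \<in> gens" using cons by simp
    have "Poly_Mapping.single (Word (g # gs)) (1::'r) = nc_gen g * Poly_Mapping.single (Word gs) 1"
      by (simp add: nc_gen_def mult_single plus_free_word_def)
    moreover have "Poly_Mapping.single (Word gs) (1::'r) \<in> free_algebra gens"
      using cons by (auto simp: free_algebra_def)
    ultimately have eq: "cls (Poly_Mapping.single (Word (g # gs)) (1::'r)) = cls (nc_gen g) * ?y"
      using g by (simp add: presented_of_mult free_algebra_gen)
    show ?case unfolding eq
    proof (cases g)
      case (GenP A)
      then show "\<exists>m n. int m - int n = word_degree (Word (g # gs)) \<and> univ.monomial m n (cls (nc_gen g) * ?y)"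
        using mn univ.monomial_p_left[OF mn(2), of A] by (auto simp: word_degree_def)
    next
      case (GenS \<alpha> B)
      with g have "\<alpha> \<in> L" "B \<in> \<I> \<alpha>" by (auto simp: gbds_gens_def)
      then have "univ.monomial (Suc m) n (cls (nc_gen g) * ?y)" using univ.monomial.s[OF mn(2), of \<alpha> B] GenS by simp
      with GenS mn show "\<exists>m n. int m - int n = word_degree (Word (g # gs)) \<and> univ.monomial m n (cls (nc_gen g) * ?y)"
        by (intro exI[of _ "Suc m"] exI[of _ n]) (auto simp: word_degree_def)
    next
      case (GenT \<alpha> B)
      with g have a: "\<alpha> \<in> L" "B \<in> \<I> \<alpha>" by (auto simp: gbds_gens_def)
      show "\<exists>m n. int m - int n = word_degree (Word (g # gs)) \<and> univ.monomial m n (cls (nc_gen g) * ?y)"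
      proof (cases m)
        case 0
        with mn univ.monomial_t_left_0[OF a] have "univ.monomial 0 (Suc n) (cls (nc_gen g) * ?y)" by (simp add: GenT)
        with GenT mn 0 show ?thesis
          by (intro exI[of _ 0] exI[of _ "Suc n"]) (auto simp: word_degree_def)
      next
        case (Suc m')
        with mn univ.monomial_t_left[OF a, of m'] have "univ.monomial m' n (cls (nc_gen g) * ?y)" by (simp add: GenT)
        with GenT mn Suc show ?thesis
          by (intro exI[of _ m'] exI[of _ n]) (auto simp: word_degree_def)
      qed
    qed
  qed
  from this[of "letters w"] assms show ?thesis by simp
qed

lemma cls_homogeneous:
  fixes x :: "('b, 'l, 'r::{comm_ring, comm_monoid_mult}) gbds_poly"
  assumes x: "x \<in> free_algebra gens" and deg: "\<And>w. w \<in> Poly_Mapping.keys x \<Longrightarrow> word_degree w = d"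
  shows "\<exists>N. cls x \<in> univ.monomial_span N d"
proof -
  let ?x = "\<lambda>w. Poly_Mapping.single w (Poly_Mapping.lookup x w)"
  have "\<exists>N. cls (\<Sum>w\<in>W. ?x w) \<in> univ.monomial_span N d" if "W \<subseteq> Poly_Mapping.keys x" for W
    using finite_subset[OF that finite_keys] that
  proof (induction W rule: finite_induct)
    case empty
    then show ?case by (auto simp: presented_of_zero intro: univ.monomial_span.zero)
  next
    case (insert w W)
    then obtain N where N: "cls (\<Sum>w\<in>W. ?x w) \<in> univ.monomial_span N d" by auto
    have w: "letters w \<noteq> []" "set (letters w) \<subseteq> gens" "word_degree w = d"
      using insert x deg by (auto simp: free_algebra_def)
    with cls_word[of w, where 'r='r] obtain m n where mn: "int m - int n = d"
      "univ.monomial m n (cls (Poly_Mapping.single w (1::'r)))" by auto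
    have free: "?x v \<in> free_algebra gens" if "v \<in> insert w W" for v
      using insert that x by (auto simp: free_algebra_def split: if_splits)
    have "Poly_Mapping.single w (1::'r) \<in> free_algebra gens" using w by (auto simp: free_algebra_def)
    then have "cls (?x w) = presented_scale (Poly_Mapping.lookup x w) (cls (Poly_Mapping.single w (1::'r)))"
      by (simp add: nc_scale_single flip: presented_of_scale)
    then have "cls (\<Sum>w\<in>insert w W. ?x w) = cls (\<Sum>w\<in>W. ?x w) +
        presented_scale (Poly_Mapping.lookup x w) (cls (Poly_Mapping.single w (1::'r)))"
      using insert free by (simp add: presented_of_add free_algebra_sum add.commute)
    moreover have "cls (\<Sum>w\<in>W. ?x w) \<in> univ.monomial_span (max N (m + n)) d"
      using N by (rule univ.monomial_span_weaken) simp
    ultimately show ?case using mn by (auto intro!: exI[of _ "max N (m + n)"] univ.monomial_span.add)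
  qed
  from this[of "Poly_Mapping.keys x"] show ?thesis by (simp flip: nc_poly_as_sum)
qed

end

section \<open>Injectivity of graded homomorphisms\<close>

text \<open>The homogeneous component of degree \<open>n\<close> of a noncommutative polynomial.\<close>

definition hom_part ::
    "int \<Rightarrow> ('b, 'l, 'r::{comm_ring, comm_monoid_mult}) gbds_poly \<Rightarrow> ('b, 'l, 'r) gbds_poly" where
  "hom_part n x = (\<Sum>w | w \<in> Poly_Mapping.keys x \<and> word_degree w = n.
     Poly_Mapping.single w (Poly_Mapping.lookup x w))"

lemma lookup_hom_part:
  "Poly_Mapping.lookup (hom_part n x) w = (if word_degree w = n then Poly_Mapping.lookup x w else 0)"
  by (auto simp: hom_part_def lookup_sum lookup_single when_def in_keys_iff sum.delta)

lemma sum_hom_part: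
  "x = (\<Sum>n \<in> word_degree ` Poly_Mapping.keys x. hom_part n x)"
  by (rule poly_mapping_eqI) (auto simp: lookup_sum lookup_hom_part in_keys_iff sum.delta)

lemma hom_part_free_algebra: "x \<in> free_algebra X \<Longrightarrow> hom_part n x \<in> free_algebra X"
  by (auto simp: free_algebra_def in_keys_iff lookup_hom_part split: if_splits)

context relative_gbds
begin

lemma graded_uniqueness_if:
  fixes f :: "('b, 'l, 'r::{comm_ring, comm_monoid_mult}) gbds_poly set \<Rightarrow> 'a::ring"
  assumes gr: "Z_graded_algebra scale gr" and f: "LR_graded_hom L \<theta> \<I> \<J> scale gr f"
    and P: "\<And>r A. r \<noteq> 0 \<Longrightarrow> A \<noteq> bot \<Longrightarrow> f (LR_scale L \<theta> \<I> \<J> r (LR_p L \<theta> \<I> \<J> A)) \<noteq> 0"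
    and Q: "\<And>r A. r \<noteq> 0 \<Longrightarrow> A \<in> regular L \<theta> - \<J> \<Longrightarrow> f (LR_scale L \<theta> \<I> \<J> r (LR_q L \<theta> \<I> \<J> A)) \<noteq> 0"
  shows "inj_on f (LR_carrier L \<theta> \<I> \<J>)"
proof -
  interpret A: Z_graded_algebra scale gr by (rule gr)
  let ?F = "free_algebra gens :: ('b, 'l, 'r) gbds_poly set"
  define g where "g x = f (LR_class L \<theta> \<I> \<J> x)" for x
  have hom: "LR_algebra_hom L \<theta> \<I> \<J> scale f" using f by (simp add: LR_graded_hom_def)
  have g_add: "g (x + y) = g x + g y" and g_mult: "g (x * y) = g x * g y" if "x \<in> ?F" "y \<in> ?F" for x y
    using hom that unfolding g_def LR_algebra_hom_def
    by (simp_all flip: LR_add_class LR_mult_class add: LR_class_mem)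
  have g_zero: "g 0 = 0" using g_add[of 0 0] by (simp add: free_algebra_zero)
  have g_diff: "g (x - y) = g x - g y" if "x \<in> ?F" "y \<in> ?F" for x y
    using g_add[of "x - y" y] that by (simp add: free_algebra_diff)
  have g_sum: "g (sum x I) = (\<Sum>i\<in>I. g (x i))" if "\<And>i. i \<in> I \<Longrightarrow> x i \<in> ?F" for x :: "int \<Rightarrow> _" and I
    using that by (induction I rule: infinite_finite_induct) (auto simp: g_zero g_add free_algebra_sum)
  \<comment> \<open>As \<open>g\<close> is constant on congruence classes, an element of the free algebra is mapped into \<open>K\<close>
      exactly if \<open>g\<close> annihilates it.\<close>
  define K where "K = cls ` {x \<in> ?F. g x = 0}"
  have cls_K: "cls x \<in> K \<longleftrightarrow> g x = 0" if "x \<in> ?F" for x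
  proof
    assume "cls x \<in> K"
    then obtain y where y: "y \<in> ?F" "g y = 0" "cls x = cls y" by (auto simp: K_def)
    with that have "(x, y) \<in> LR_cong L \<theta> \<I> \<J>" by (simp add: presented_of_eq_iff LR_cong_def)
    with y show "g x = 0" by (simp add: g_def LR_class_eq)
  qed (use that in \<open>auto simp: K_def\<close>)
  have q: "univ.q A = cls (polyP A - (\<Sum>\<alpha> \<in> Delta L \<theta> A. polyS \<alpha> (\<theta> \<alpha> A) * polyT \<alpha> (\<theta> \<alpha> A)))" for A
    unfolding univ.q_def cls_sum_st[symmetric]
    by (rule presented_of_diff[symmetric]) (auto simp: Delta_def intro!: free_algebra_rules)
  interpret K: gbds_kernel L \<theta> \<I> \<J> presented_scale
    "\<lambda>A. cls (polyP A)" "\<lambda>\<alpha> B. cls (polyS \<alpha> B)" "\<lambda>\<alpha> B. cls (polyT \<alpha> B)" K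
  proof (unfold_locales, goal_cases)
    case (1 x y)
    then obtain x' y' where "x' \<in> ?F" "g x' = 0" "x = cls x'" "y' \<in> ?F" "g y' = 0" "y = cls y'"
      by (auto simp: K_def)
    then show ?case by (simp add: cls_K g_diff free_algebra_diff flip: presented_of_diff)
  next
    case (2 x A)
    then obtain x' where "x' \<in> ?F" "g x' = 0" "x = cls x'" by (auto simp: K_def)
    then show ?case by (simp add: cls_K g_mult free_algebra_rules flip: presented_of_mult)
  next
    case (3 x \<alpha> B)
    then obtain x' where "x' \<in> ?F" "g x' = 0" "x = cls x'" by (auto simp: K_def)
    with 3 show ?case by (simp add: cls_K g_mult free_algebra_rules flip: presented_of_mult)
  next
    case (4 x \<alpha> B)
    then obtain x' where "x' \<in> ?F" "g x' = 0" "x = cls x'" by (auto simp: K_def)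
    with 4 show ?case by (simp add: cls_K g_mult free_algebra_rules flip: presented_of_mult)
  next
    case (5 r A)
    have "g (nc_scale r (polyP A)) \<noteq> 0"
      using P[OF 5] by (simp add: LR_p_def LR_scale_class gens_free_algebra g_def)
    then show ?case by (simp add: cls_K gens_free_algebra free_algebra_scale flip: presented_of_scale)
  next
    case (6 r A)
    have "g (nc_scale r (polyP A - (\<Sum>\<alpha> \<in> Delta L \<theta> A. polyS \<alpha> (\<theta> \<alpha> A) * polyT \<alpha> (\<theta> \<alpha> A)))) \<noteq> 0"
      using Q[OF 6] by (simp add: LR_q_def LR_scale_class[OF pq_free_algebra(2)] g_def)
    then show ?case unfolding q
      by (simp add: cls_K[OF free_algebra_scale[OF pq_free_algebra(2)]] flip: presented_of_scale[OF pq_free_algebra(2)])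
  qed
  \<comment> \<open>The sum of the grading of the target is direct, so \<open>g\<close> annihilates the homogeneous components
      of any element that it annihilates.\<close>
  have hom_zero: "cls x = 0" if x: "x \<in> ?F" and gx: "g x = 0" for x
  proof -
    let ?D = "word_degree ` Poly_Mapping.keys x"
    have part: "hom_part n x \<in> ?F" for n using x by (rule hom_part_free_algebra)
    define c where "c n = g (hom_part n x)" for n
    have c_gr: "c n \<in> gr n" for n
    proof -
      have "LR_class L \<theta> \<I> \<J> (hom_part n x) \<in> LR_component L \<theta> \<I> \<J> n"
        unfolding LR_component_def using part by (auto simp: in_keys_iff lookup_hom_part split: if_splits)
      with f show ?thesis by (auto simp: c_def g_def LR_graded_hom_def)
    qed
    have "hom_part n x = 0" if "n \<notin> ?D" for n
      using that by (intro poly_mapping_eqI) (auto simp: lookup_hom_part in_keys_iff)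
    then have c_out: "c n = 0" if "n \<notin> ?D" for n using that by (simp add: c_def g_zero)
    then have sub: "{n. c n \<noteq> 0} \<subseteq> ?D" by blast
    have "0 = (\<Sum>n\<in>?D. c n)"
      using gx sum_hom_part[of x] g_sum[of ?D "\<lambda>n. hom_part n x"] part by (simp add: c_def)
    also have "\<dots> = (\<Sum>n | c n \<noteq> 0. c n)"
      using sub by (intro sum.mono_neutral_right) auto
    finally have "0 = (\<Sum>n | c n \<noteq> 0. c n)" .
    moreover have "finite {n. c n \<noteq> 0}" using sub by (rule finite_subset) simp
    ultimately have "(\<forall>n. c n \<in> gr n) \<and> finite {n. c n \<noteq> 0} \<and> 0 = (\<Sum>n | c n \<noteq> 0. c n)"
      using c_gr by blast
    moreover have "(\<forall>n. (\<lambda>_. 0) n \<in> gr n) \<and> finite {n::int. (0::'a) \<noteq> 0} \<and> (0::'a) = (\<Sum>n::int | (0::'a) \<noteq> 0. 0)"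
      using A.zero_mem by simp
    moreover have "a = b" if "\<exists>!x. P x" "P a" "P b" for P and a b :: "int \<Rightarrow> 'a"
      using that by blast
    note this[OF A.direct_sum[of 0], of c "\<lambda>_. 0"]
    ultimately have "c = (\<lambda>_. 0)" by blast
    then have "g (hom_part n x) = 0" for n by (simp add: c_def fun_eq_iff)
    then have "cls (hom_part n x) = 0" for n
    proof -
      have "\<exists>N. cls (hom_part n x) \<in> univ.monomial_span N n"
        using part by (rule cls_homogeneous) (auto simp: in_keys_iff lookup_hom_part split: if_splits)
      with \<open>\<And>n. g (hom_part n x) = 0\<close> part show ?thesis using K.homogeneous_kernel cls_K by metis
    qed
    then have "cls (\<Sum>n\<in>?D. hom_part n x) = 0"
      using part by (simp add: presented_of_sum)
    then show ?thesis by (simp flip: sum_hom_part)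
  qed
  show ?thesis
  proof (rule inj_onI)
    fix U V assume UV: "U \<in> LR_carrier L \<theta> \<I> \<J>" "V \<in> LR_carrier L \<theta> \<I> \<J>" "f U = f V"
    then obtain x y where xy: "x \<in> ?F" "y \<in> ?F" "U = LR_class L \<theta> \<I> \<J> x" "V = LR_class L \<theta> \<I> \<J> y"
      by (auto simp: LR_carrier_def LR_class_def elim!: quotientE)
    with UV have "g (x - y) = 0" by (simp add: g_diff) (simp add: g_def)
    with xy hom_zero[of "x - y"] have "cls x = cls y" by (simp add: presented_of_diff free_algebra_diff)
    with xy show "U = V" by (simp add: presented_of_eq_iff LR_cong_def LR_class_eq)
  qed
qed

end

section \<open>Characters of generalized Boolean algebras\<close>

text \<open>Lattice homomorphisms to the two-element Boolean algebra that preserve the least element. The zero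
  homomorphism is allowed, since a nonzero character may vanish on the range of \<open>\<theta> \<alpha>\<close>.\<close>

definition character :: "('b::generalized_boolean_algebra \<Rightarrow> bool) \<Rightarrow> bool" where
  "character \<chi> \<longleftrightarrow> \<not> \<chi> bot \<and> (\<forall>A B. \<chi> (sup A B) = (\<chi> A \<or> \<chi> B) \<and> \<chi> (inf A B) = (\<chi> A \<and> \<chi> B))"

lemma character_diff: "character \<chi> \<Longrightarrow> \<chi> (A - B) = (\<chi> A \<and> \<not> \<chi> B)"
  unfolding character_def by (metis inf_relcomp sup_relcomp)

lemma gba_ideal_downward: "gba_ideal M \<Longrightarrow> A \<le> B \<Longrightarrow> B \<in> M \<Longrightarrow> A \<in> M"
  unfolding gba_ideal_def by (metis inf.absorb2)

lemma gba_ideal_bot: "gba_ideal M \<Longrightarrow> bot \<in> M"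
  using gba_ideal_downward[of M bot] by (auto simp: gba_ideal_def)

text \<open>The prime ideal theorem: an ideal disjoint from a set closed under meets is contained in
  a maximal such ideal, which is prime, and the indicator function of its complement is a character.\<close>

lemma exists_character:
  fixes G M :: "'b::generalized_boolean_algebra set"
  assumes M: "gba_ideal M" and G: "\<And>A B. A \<in> G \<Longrightarrow> B \<in> G \<Longrightarrow> inf A B \<in> G"
    and disjoint: "G \<inter> M = {}"
  obtains \<chi> where "character \<chi>" "\<And>A. A \<in> G \<Longrightarrow> \<chi> A" "\<And>A. A \<in> M \<Longrightarrow> \<not> \<chi> A"
proof -
  let ?S = "{N. gba_ideal N \<and> M \<subseteq> N \<and> G \<inter> N = {}}"
  have "\<exists>N\<in>?S. \<forall>N'\<in>?S. N \<subseteq> N' \<longrightarrow> N' = N"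
  proof (rule subset_Zorn_nonempty)
    show "?S \<noteq> {}" using M disjoint by blast
    fix C assume C: "C \<noteq> {}" "subset.chain ?S C"
    then have CS: "C \<subseteq> ?S" and chain: "\<And>N N'. N \<in> C \<Longrightarrow> N' \<in> C \<Longrightarrow> N \<subseteq> N' \<or> N' \<subseteq> N"
      by (auto simp: subset_chain_def)
    have "gba_ideal (\<Union>C)"
      unfolding gba_ideal_def
    proof (intro conjI ballI allI)
      obtain N where "N \<in> C" using C by blast
      with CS have "bot \<in> \<Union>C" using gba_ideal_bot by blast
      then show "\<Union>C \<noteq> {}" by blast
    next
      fix A B assume "A \<in> \<Union>C" "B \<in> \<Union>C"
      then obtain N where "N \<in> C" "A \<in> N" "B \<in> N" using chain by blast
      moreover from this CS have "gba_ideal N" by blast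
      ultimately show "sup A B \<in> \<Union>C" unfolding gba_ideal_def by blast
    next
      fix A B assume "A \<in> \<Union>C"
      then obtain N where "N \<in> C" "A \<in> N" by blast
      moreover from this CS have "gba_ideal N" by blast
      ultimately show "inf A B \<in> \<Union>C" unfolding gba_ideal_def by blast
    qed
    with C CS show "\<Union>C \<in> ?S" by blast
  qed
  then obtain N where N: "gba_ideal N" "M \<subseteq> N" "G \<inter> N = {}"
    and max0: "\<forall>N'\<in>?S. N \<subseteq> N' \<longrightarrow> N' = N" by auto
  have max: "N' = N" if "gba_ideal N'" "G \<inter> N' = {}" "N \<subseteq> N'" for N'
    using max0[rule_format, of N'] that N(2) by simp
  have N_sup: "sup A B \<in> N" if "A \<in> N" "B \<in> N" for A B using N(1) that by (auto simp: gba_ideal_def)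
  have enlarge: "\<exists>g\<in>G. \<exists>m\<in>N. g \<le> sup m A" if "A \<notin> N" for A
  proof (rule ccontr)
    assume no: "\<not> ?thesis"
    let ?N = "{X. \<exists>m\<in>N. X \<le> sup m A}"
    have "gba_ideal ?N" unfolding gba_ideal_def
    proof (intro conjI ballI allI)
      show "?N \<noteq> {}" using gba_ideal_bot[OF N(1)] bot_least by blast
    next
      fix X Y assume "X \<in> ?N" "Y \<in> ?N"
      then obtain m m' where m: "m \<in> N" "X \<le> sup m A" "m' \<in> N" "Y \<le> sup m' A" by blast
      moreover have "sup m A \<le> sup (sup m m') A" "sup m' A \<le> sup (sup m m') A"
        by (intro sup_mono sup_ge1 sup_ge2 order_refl)+
      ultimately have "X \<le> sup (sup m m') A" "Y \<le> sup (sup m m') A"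
        by (auto intro: order_trans)
      then have "sup X Y \<le> sup (sup m m') A" by simp
      with m N_sup show "sup X Y \<in> ?N" by blast
    next
      fix X Y assume "X \<in> ?N"
      then show "inf X Y \<in> ?N" using le_infI1 by blast
    qed
    moreover have "G \<inter> ?N = {}" using no by blast
    moreover have "N \<subseteq> ?N" using sup_ge1 by blast
    moreover have "A \<in> ?N" using gba_ideal_bot[OF N(1)] sup_ge2 by blast
    ultimately show False using max[of ?N] that by blast
  qed
  have prime: "A \<in> N \<or> B \<in> N" if "inf A B \<in> N" for A B
  proof (rule ccontr)
    assume "\<not> ?thesis"
    then obtain g m g' m' where g: "g \<in> G" "m \<in> N" "g \<le> sup m A" "g' \<in> G" "m' \<in> N" "g' \<le> sup m' B"
      using enlarge by blast
    have "inf g g' \<le> inf (sup m A) (sup m' B)" using g by (intro inf_mono)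
    also have "\<dots> \<le> inf (sup (sup m m') A) (sup (sup m m') B)"
      by (intro inf_mono sup_mono) auto
    also have "\<dots> = sup (sup m m') (inf A B)" by (simp add: sup_inf_distrib1)
    finally have "inf g g' \<in> N"
      using N_sup g that gba_ideal_downward[OF N(1)] by metis
    with G g N(3) show False by blast
  qed
  show thesis
  proof (rule that[of "\<lambda>A. A \<notin> N"])
    show "character (\<lambda>A. A \<notin> N)"
      unfolding character_def
      using gba_ideal_bot[OF N(1)] gba_ideal_downward[OF N(1)] N_sup prime inf_le1 inf_le2 sup_ge1 sup_ge2
      by metis
  qed (use N in auto)
qed

section \<open>The representation on boundary paths\<close>

text \<open>Finite or infinite sequences of characters connected by labels. The constructor \<open>Step\<close> stores the
  character at the beginning of the path although \<open>boundary\<close> below determines it by the rest, because a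
  recursion through the rest would not end on an infinite path.\<close>

codatatype ('b, 'l) path =
  Stop (root: "'b \<Rightarrow> bool") | Step (root: "'b \<Rightarrow> bool") 'l "('b, 'l) path"

text \<open>The path that starts at \<open>\<chi>\<close> and continues as \<open>nx\<close> prescribes.\<close>

primcorec unfold_path :: "(('b \<Rightarrow> bool) \<Rightarrow> ('l \<times> ('b \<Rightarrow> bool)) option) \<Rightarrow> ('b \<Rightarrow> bool) \<Rightarrow> ('b, 'l) path" where
  "unfold_path nx \<chi> = (case nx \<chi> of None \<Rightarrow> Stop \<chi> | Some (\<alpha>, \<chi>') \<Rightarrow> Step \<chi> \<alpha> (unfold_path nx \<chi>'))"

lemma root_unfold_path: "root (unfold_path nx \<chi>) = \<chi>"
  by (subst unfold_path.code) (auto split: option.split)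

context relative_gbds
begin

text \<open>A step with label \<open>\<alpha>\<close> leads from the character \<open>\<chi> \<circ> \<theta> \<alpha>\<close> to the character \<open>\<chi>\<close>. A path may
  end only at a character that vanishes on \<open>\<J>\<close>; this is what makes the relation
  $p_A=\sum_\alpha s_{\alpha,\theta_\alpha(A)}s_{\alpha,\theta_\alpha(A)}^*$ hold for $A\in\mathcal J$.\<close>

coinductive_set boundary :: "('b, 'l) path set" where
  Stop: "character \<chi> \<Longrightarrow> (\<And>A. A \<in> \<J> \<Longrightarrow> \<not> \<chi> A) \<Longrightarrow> Stop \<chi> \<in> boundary"
| Step: "x \<in> boundary \<Longrightarrow> character (root x) \<Longrightarrow> \<alpha> \<in> L \<Longrightarrow> Step (root x \<circ> \<theta> \<alpha>) \<alpha> x \<in> boundary"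

lemma character_comp: "character \<chi> \<Longrightarrow> \<alpha> \<in> L \<Longrightarrow> character (\<chi> \<circ> \<theta> \<alpha>)"
  by (simp add: character_def theta_bot theta_sup theta_inf)

text \<open>Where a path may not end, it can be continued. Finiteness of $\Delta_A$ and regularity of \<open>A\<close> yield
  a single label \<open>\<alpha>\<close> with $\theta_\alpha(D)\neq\emptyset$ for all \<open>D\<close> in the ultrafilter of \<open>\<chi>\<close>, and
  the prime ideal theorem then extends \<open>\<chi>\<close> along \<open>\<theta> \<alpha>\<close>.\<close>

lemma character_extend:
  assumes \<chi>: "character \<chi>" "\<chi> A" and A: "A \<in> \<J>"
  shows "\<exists>\<alpha> \<chi>'. \<alpha> \<in> L \<and> character \<chi>' \<and> \<chi> = \<chi>' \<circ> \<theta> \<alpha>"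
proof -
  have A_nz: "A \<noteq> bot" using \<chi> by (auto simp: character_def)
  have reg: "A \<in> regular L \<theta>" using A J_regular by blast
  have "\<exists>\<alpha>\<in>L. \<forall>D\<le>A. \<chi> D \<longrightarrow> \<theta> \<alpha> D \<noteq> bot"
  proof (rule ccontr)
    assume no: "\<not> ?thesis"
    have "\<exists>D\<le>A. \<chi> D \<and> (\<forall>\<alpha>\<in>F. \<theta> \<alpha> D = bot)" if "finite F" "F \<subseteq> L" for F
      using that
    proof (induction F rule: finite_induct)
      case (insert \<alpha> F)
      then obtain D where D: "D \<le> A" "\<chi> D" "\<forall>\<alpha>\<in>F. \<theta> \<alpha> D = bot" by auto
      from no insert.prems obtain D' where D': "D' \<le> A" "\<chi> D'" "\<theta> \<alpha> D' = bot" by blast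
      have "\<forall>\<beta>\<in>insert \<alpha> F. \<theta> \<beta> (inf D D') = bot"
        using D(3) D'(3) insert.prems by (auto simp: theta_inf)
      moreover have "\<chi> (inf D D')" using D D' \<chi> by (simp add: character_def)
      ultimately show ?case using D(1) le_infI1 by blast
    qed (use \<chi> in auto)
    moreover have "finite (Delta L \<theta> A)" using reg A_nz by (auto simp: regular_def)
    ultimately obtain D where D: "D \<le> A" "\<chi> D" "\<forall>\<alpha>\<in>Delta L \<theta> A. \<theta> \<alpha> D = bot"
      by (metis (no_types, lifting) Delta_def mem_Collect_eq subsetI)
    have "\<theta> \<alpha> D = bot" if "\<alpha> \<in> L" for \<alpha>
      using D(3) theta_mono[OF that D(1)] that
      by (cases "\<theta> \<alpha> A = bot") (auto simp: Delta_def bot_unique)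
    then have "Delta L \<theta> D = {}" by (auto simp: Delta_def)
    moreover have "D \<noteq> bot" using D \<chi> by (auto simp: character_def)
    ultimately show False using reg D(1) by (auto simp: regular_def)
  qed
  then obtain \<alpha> where \<alpha>: "\<alpha> \<in> L" "\<And>D. D \<le> A \<Longrightarrow> \<chi> D \<Longrightarrow> \<theta> \<alpha> D \<noteq> bot" by blast
  have nz: "\<theta> \<alpha> D \<noteq> bot" if "\<chi> D" for D
  proof
    assume "\<theta> \<alpha> D = bot"
    then have "\<theta> \<alpha> (inf D A) = bot" using \<alpha>(1) by (simp add: theta_inf)
    moreover have "\<chi> (inf D A)" using that \<chi> by (simp add: character_def)
    ultimately show False using \<alpha>(2)[of "inf D A"] by simp
  qed
  let ?M = "{E. \<exists>D. \<not> \<chi> D \<and> E \<le> \<theta> \<alpha> D}" and ?G = "\<theta> \<alpha> ` {D. \<chi> D}"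
  have M: "gba_ideal ?M" unfolding gba_ideal_def
  proof (intro conjI ballI allI)
    show "?M \<noteq> {}" using \<chi> by (auto simp: character_def intro: exI[of _ bot])
  next
    fix X Y assume "X \<in> ?M" "Y \<in> ?M"
    then obtain D D' where D: "\<not> \<chi> D" "X \<le> \<theta> \<alpha> D" "\<not> \<chi> D'" "Y \<le> \<theta> \<alpha> D'" by blast
    then have "sup X Y \<le> \<theta> \<alpha> (sup D D')" "\<not> \<chi> (sup D D')"
      using \<alpha>(1) \<chi> by (auto simp: theta_sup character_def intro: le_supI1 le_supI2)
    then show "sup X Y \<in> ?M" by blast
  next
    fix X Y assume "X \<in> ?M"
    then show "inf X Y \<in> ?M" using le_infI1 by blast
  qed
  have disj: "?G \<inter> ?M = {}"
  proof (rule ccontr)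
    assume "?G \<inter> ?M \<noteq> {}"
    then obtain D D' where D: "\<chi> D" "\<not> \<chi> D'" "\<theta> \<alpha> D \<le> \<theta> \<alpha> D'" by blast
    have "\<theta> \<alpha> (D - D') = inf (\<theta> \<alpha> D') (\<theta> \<alpha> D - \<theta> \<alpha> D')"
      using D(3) diff_le[of "\<theta> \<alpha> D" "\<theta> \<alpha> D'"] \<alpha>(1) by (auto simp: theta_diff inf_absorb2 intro: order_trans)
    then have "\<theta> \<alpha> (D - D') = bot" by (simp add: inf_relcomp)
    with nz[of "D - D'"] D \<chi> show False by (simp add: character_diff)
  qed
  have G: "inf X Y \<in> ?G" if XY: "X \<in> ?G" "Y \<in> ?G" for X Y
  proof -
    from XY obtain D D' where "\<chi> D" "X = \<theta> \<alpha> D" "\<chi> D'" "Y = \<theta> \<alpha> D'" by blast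
    then have "inf X Y = \<theta> \<alpha> (inf D D')" "\<chi> (inf D D')"
      using \<alpha>(1) \<chi> by (auto simp: theta_inf character_def)
    then show ?thesis by blast
  qed
  obtain \<chi>' where \<chi>': "character \<chi>'" "\<And>A. A \<in> ?G \<Longrightarrow> \<chi>' A" "\<And>A. A \<in> ?M \<Longrightarrow> \<not> \<chi>' A"
    using exists_character[OF M G disj] by blast
  have "\<chi> D = \<chi>' (\<theta> \<alpha> D)" for D
    using \<chi>'(2,3)[of "\<theta> \<alpha> D"] by (cases "\<chi> D") auto
  then have "\<chi> = \<chi>' \<circ> \<theta> \<alpha>" by auto
  with \<alpha>(1) \<chi>'(1) show ?thesis by blast
qed

lemma exists_boundary_path:
  assumes "character \<chi>"
  obtains x where "x \<in> boundary" "root x = \<chi>"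
proof -
  \<comment> \<open>Choose a continuation for each character that does not vanish on \<open>\<J>\<close> and follow the choices.\<close>
  let ?ok = "\<lambda>\<chi> (\<alpha>, \<chi>'). \<alpha> \<in> L \<and> character \<chi>' \<and> \<chi> = \<chi>' \<circ> \<theta> \<alpha>"
  define nx where "nx \<chi> = (if \<exists>A\<in>\<J>. \<chi> A then Some (SOME s. ?ok \<chi> s) else None)" for \<chi>
  have nx: "?ok \<chi> s" if "character \<chi>" "nx \<chi> = Some s" for \<chi> s
  proof -
    from that(2) obtain A where "A \<in> \<J>" "\<chi> A" and s: "s = (SOME s. ?ok \<chi> s)"
      by (auto simp: nx_def split: if_splits)
    then have "\<exists>s. ?ok \<chi> s" using character_extend[OF that(1)] by auto
    then show ?thesis unfolding s by (rule someI_ex)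
  qed
  have "unfold_path nx \<chi> \<in> boundary" if "character \<chi>" for \<chi>
    using that
  proof (coinduction arbitrary: \<chi> rule: boundary.coinduct)
    case (boundary \<chi>)
    let ?x = "unfold_path nx \<chi>"
    show ?case
    proof (cases "nx \<chi>")
      case None
      with boundary have "?x = Stop \<chi>" "\<And>A. A \<in> \<J> \<Longrightarrow> \<not> \<chi> A"
        by (auto simp: unfold_path.code nx_def split: if_splits)
      with boundary show ?thesis by auto
    next
      case (Some s)
      obtain \<alpha> \<chi>' where s: "s = (\<alpha>, \<chi>')" by (cases s)
      with nx[OF boundary Some] have ok: "\<alpha> \<in> L" "character \<chi>'" "\<chi> = \<chi>' \<circ> \<theta> \<alpha>" by auto
      have "?x = Step \<chi> \<alpha> (unfold_path nx \<chi>')" using Some s by (simp add: unfold_path.code)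
      with ok show ?thesis by (auto simp: root_unfold_path)
    qed
  qed
  with assms that[of "unfold_path nx \<chi>"] show thesis by (auto simp: root_unfold_path)
qed

lemma character_root: "x \<in> boundary \<Longrightarrow> character (root x)"
  by (erule boundary.cases) (auto intro: character_comp)

end

text \<open>The generators act on paths as partial maps: $p_A$ restricts to the paths that begin in \<open>A\<close>,
  $s_{\alpha,B}$ prepends a step with label \<open>\<alpha>\<close> to the paths that begin in \<open>B\<close>, and $s_{\alpha,B}^*$
  removes it again.\<close>

primrec gen_map :: "('l \<Rightarrow> 'b \<Rightarrow> 'b) \<Rightarrow> ('b, 'l) gbds_gen \<Rightarrow> ('b, 'l) path \<Rightarrow> ('b, 'l) path option" where
  "gen_map \<theta> (GenP A) x = (if root x A then Some x else None)"
| "gen_map \<theta> (GenS \<alpha> B) x = (if root x B then Some (Step (root x \<circ> \<theta> \<alpha>) \<alpha> x) else None)"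
| "gen_map \<theta> (GenT \<alpha> B) x =
    (case x of Stop \<chi> \<Rightarrow> None | Step \<chi> \<beta> y \<Rightarrow> if \<beta> = \<alpha> \<and> root y B then Some y else None)"

text \<open>Composition of the partial maps along a word, the rightmost letter being applied first.\<close>

primrec word_map :: "('g \<Rightarrow> 'x \<Rightarrow> 'x option) \<Rightarrow> 'g list \<Rightarrow> 'x \<Rightarrow> 'x option" where
  "word_map \<phi> [] x = Some x"
| "word_map \<phi> (g # gs) x = Option.bind (word_map \<phi> gs x) (\<phi> g)"

lemma word_map_append: "word_map \<phi> (u @ v) x = Option.bind (word_map \<phi> v x) (word_map \<phi> u)"
  by (induction u) simp_all

text \<open>The action on scalar functions on paths that is obtained by composing a function with the partial
  maps. This is contravariant, so the functions become a right module; see \<open>act_mult\<close> below.\<close>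

definition act :: "('g \<Rightarrow> 'x \<Rightarrow> 'x option) \<Rightarrow> ('g, 'r::{comm_ring, comm_monoid_mult}) nc_poly
    \<Rightarrow> ('x \<Rightarrow> 'r) \<Rightarrow> 'x \<Rightarrow> 'r" where
  "act \<phi> a m x = (\<Sum>w \<in> Poly_Mapping.keys a. Poly_Mapping.lookup a w *
     (case word_map \<phi> (letters w) x of None \<Rightarrow> 0 | Some y \<Rightarrow> m y))"

lemma act_superset:
  "finite W \<Longrightarrow> Poly_Mapping.keys a \<subseteq> W \<Longrightarrow> act \<phi> a m x = (\<Sum>w \<in> W. Poly_Mapping.lookup a w *
     (case word_map \<phi> (letters w) x of None \<Rightarrow> 0 | Some y \<Rightarrow> m y))"
  unfolding act_def by (intro sum.mono_neutral_left) (auto simp: in_keys_iff)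

lemma act_single: "act \<phi> (Poly_Mapping.single w c) m x =
    c * (case word_map \<phi> (letters w) x of None \<Rightarrow> 0 | Some y \<Rightarrow> m y)"
  by (simp add: act_superset[of "{w}"])

lemma act_add: "act \<phi> (a + b) m x = act \<phi> a m x + act \<phi> b m x"
proof -
  let ?W = "Poly_Mapping.keys a \<union> Poly_Mapping.keys b"
  show ?thesis
    using keys_add[of a b]
    by (simp add: act_superset[of ?W] lookup_add distrib_right sum.distrib)
qed

lemma act_zero: "act \<phi> 0 m x = 0"
  by (simp add: act_def)

lemma act_diff: "act \<phi> (a - b) m x = act \<phi> a m x - act \<phi> b m x"
  using act_add[of \<phi> "a - b" b m x] by simp

lemma act_scale: "act \<phi> (nc_scale r a) m x = r * act \<phi> a m x"
  by (induction a rule: nc_poly_induct)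
    (simp_all add: nc_scale_single nc_scale_add act_single act_add distrib_left mult.assoc)

lemma act_sum: "act \<phi> (sum a I) m x = (\<Sum>i\<in>I. act \<phi> (a i) m x)"
  by (induction I rule: infinite_finite_induct) (simp_all add: act_zero act_add)

lemma act_gen: "act \<phi> (nc_gen g) m x = (case \<phi> g x of None \<Rightarrow> 0 | Some y \<Rightarrow> m y)"
  by (simp add: nc_gen_def act_single)

lemma act_mult: "act \<phi> (a * b) m x = act \<phi> b (act \<phi> a m) x"
proof (induction b rule: nc_poly_induct)
  case (single v d)
  show ?case
  proof (induction a rule: nc_poly_induct)
    case (single u c)
    show ?case
      by (simp add: mult_single act_single plus_free_word_def word_map_append mult.assoc
          mult.left_commute split: option.split bind_splits)
  next
    case (add a a')
    then show ?case
      by (simp add: distrib_right act_add act_single distrib_left split: option.split)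
  qed
qed (simp add: distrib_left act_add)

lemma act_cong:
  assumes a: "a \<in> free_algebra X" and closed: "\<And>g y z. g \<in> X \<Longrightarrow> y \<in> S \<Longrightarrow> \<phi> g y = Some z \<Longrightarrow> z \<in> S"
    and "x \<in> S" "\<And>y. y \<in> S \<Longrightarrow> m y = n y"
  shows "act \<phi> a m x = act \<phi> a n x"
proof -
  have words: "z \<in> S" if "set gs \<subseteq> X" "word_map \<phi> gs x = Some z" for gs z
    using that \<open>x \<in> S\<close> by (induction gs arbitrary: z) (auto simp: closed split: bind_splits)
  show ?thesis unfolding act_def
  proof (rule sum.cong[OF refl])
    fix w assume "w \<in> Poly_Mapping.keys a"
    with a have "set (letters w) \<subseteq> X" by (auto simp: free_algebra_def)
    with words assms(4) show "Poly_Mapping.lookup a w * (case word_map \<phi> (letters w) x of None \<Rightarrow> 0 | Some y \<Rightarrow> m y) =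
        Poly_Mapping.lookup a w * (case word_map \<phi> (letters w) x of None \<Rightarrow> 0 | Some y \<Rightarrow> n y)"
      by (auto split: option.split)
  qed
qed

text \<open>If the partial maps preserve \<open>S\<close> and both sides of every equation act equally on the points of
  \<open>S\<close>, then the whole ideal acts as zero there. Invariance of \<open>S\<close> is needed for right multiples.\<close>

lemma act_generated_ideal:
  assumes closed: "\<And>g y z. g \<in> X \<Longrightarrow> y \<in> S \<Longrightarrow> \<phi> g y = Some z \<Longrightarrow> z \<in> S"
    and E: "\<And>a b m x. (a, b) \<in> E \<Longrightarrow> x \<in> S \<Longrightarrow> act \<phi> a m x = act \<phi> b m x"
  shows "a \<in> generated_ideal X E \<Longrightarrow> x \<in> S \<Longrightarrow> act \<phi> a m x = 0"
proof (induction arbitrary: m x rule: generated_ideal.induct)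
  case (mult_right a b)
  have "act \<phi> (a * b) m x = act \<phi> b (\<lambda>_. 0) x"
    unfolding act_mult using mult_right closed by (intro act_cong[of b X S]) auto
  also have "\<dots> = 0" unfolding act_def by (auto intro!: sum.neutral split: option.split)
  finally show ?case .
qed (simp_all add: act_zero act_diff act_add act_scale act_mult E)

context relative_gbds
begin

abbreviation gact where "gact \<equiv> act (gen_map \<theta>)"

lemma gen_map_boundary:
  "g \<in> gbds_gens L \<I> \<Longrightarrow> x \<in> boundary \<Longrightarrow> gen_map \<theta> g x = Some y \<Longrightarrow> y \<in> boundary"
  by (cases g) (auto simp: gbds_gens_def split: if_splits path.splits
      intro: boundary.intros character_root elim: boundary.cases)

lemma gact_relations:
  fixes a b :: "('b, 'l, 'r::{comm_ring, comm_monoid_mult}) gbds_poly"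
  assumes "(a, b) \<in> gbds_relations L \<theta> \<I> \<J>" "x \<in> boundary"
  shows "gact a m x = gact b m x"
proof -
  have root: "character (root x)" using assms(2) by (rule character_root)
  show ?thesis using assms(1)
  proof cases
    case (P_sum A)
    show ?thesis
    proof (cases x)
      case (Stop \<chi>)
      then have "\<not> \<chi> A" using assms(2) P_sum by (auto elim: boundary.cases)
      with Stop P_sum show ?thesis by (simp add: act_sum act_mult act_gen)
    next
      case (Step \<chi> \<beta> y)
      then have y: "y \<in> boundary" "character (root y)" "\<beta> \<in> L" "\<chi> = root y \<circ> \<theta> \<beta>"
        using assms(2) by (auto elim: boundary.cases)
      have "gact b m x = (\<Sum>\<alpha> \<in> Delta L \<theta> A. if \<alpha> = \<beta> then (if root y (\<theta> \<beta> A) then m x else 0) else 0)"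
        unfolding P_sum act_sum
        by (rule sum.cong[OF refl]) (auto simp: act_mult act_gen Step y)
      also have "\<dots> = (if root y (\<theta> \<beta> A) then m x else 0)"
      proof (cases "\<beta> \<in> Delta L \<theta> A")
        case True
        then have "A \<noteq> bot" by (auto simp: Delta_def theta_bot)
        then have "finite (Delta L \<theta> A)" using P_sum J_regular by (auto simp: regular_def)
        with True show ?thesis by (simp add: sum.delta)
      next
        case False
        with y have "\<not> root y (\<theta> \<beta> A)" by (auto simp: Delta_def character_def)
        with False show ?thesis by (auto intro: sum.neutral)
      qed
      also have "\<dots> = gact a m x" by (simp add: P_sum act_gen Step y)
      finally show ?thesis by simp
    qed
  next
    case P_bot
    then show ?thesis using root by (simp add: act_gen act_zero character_def)
  next
    case (P_inf A A')
    then show ?thesis using root by (simp add: act_gen act_mult character_def)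
  next
    case (P_sup A A')
    then show ?thesis using root by (simp add: act_gen act_add act_diff character_def)
  next
    case (P_S \<alpha> B A)
    then show ?thesis by (simp add: act_gen act_mult)
  next
    case (T_P \<alpha> B A)
    then show ?thesis using assms(2)
      by (cases x) (auto simp: act_gen act_mult elim: boundary.cases)
  next
    case (T_S \<alpha> B \<alpha>' B')
    then show ?thesis using root by (simp add: act_gen act_mult act_zero character_def)
  next
    case (S_inf \<alpha> B B')
    then show ?thesis using root by (simp add: act_gen act_mult character_def)
  next
    case (T_inf \<alpha> B B')
    then show ?thesis using assms(2)
      by (cases x) (auto simp: act_gen act_mult character_def elim: boundary.cases)
  qed
qed

text \<open>The first assertion evaluates $rp_A$ at a boundary path that begins in \<open>A\<close>, the second one $rq_A$ at
  a path of length \<open>0\<close> in \<open>A\<close>, which exists because some character is nonzero on \<open>A\<close> and vanishes on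
  the ideal \<open>\<J>\<close>.\<close>

lemma scale_p_q_notin_ideal:
  fixes r :: "'r::{comm_ring, comm_monoid_mult}"
  assumes "r \<noteq> 0"
  shows "A \<noteq> bot \<Longrightarrow> nc_scale r (polyP A) \<notin> generated_ideal gens rels"
    and "A \<notin> \<J> \<Longrightarrow> nc_scale r (polyP A - (\<Sum>\<alpha> \<in> Delta L \<theta> A. polyS \<alpha> (\<theta> \<alpha> A) * polyT \<alpha> (\<theta> \<alpha> A)))
      \<notin> generated_ideal gens rels"
proof -
  have vanish: "gact a m x = 0" if "a \<in> generated_ideal gens rels" "x \<in> boundary"
    for a :: "('b, 'l, 'r) gbds_poly" and m x
    using gen_map_boundary gact_relations that by (rule act_generated_ideal)
  show "nc_scale r (polyP A) \<notin> generated_ideal gens rels" if A: "A \<noteq> bot"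
  proof -
    have "gba_ideal {bot::'b}" by (simp add: gba_ideal_def)
    then obtain \<chi> where "character \<chi>" "\<chi> A"
      using exists_character[of "{bot}" "{A}"] A by auto
    then obtain x where x: "x \<in> boundary" "root x A" using exists_boundary_path by metis
    then have "gact (nc_scale r (polyP A)) (\<lambda>_. 1) x = r" by (simp add: act_scale act_gen)
    with vanish[OF _ x(1)] assms show ?thesis by auto
  qed
  show "nc_scale r (polyP A - (\<Sum>\<alpha> \<in> Delta L \<theta> A. polyS \<alpha> (\<theta> \<alpha> A) * polyT \<alpha> (\<theta> \<alpha> A)))
      \<notin> generated_ideal gens rels" if A: "A \<notin> \<J>"
  proof -
    obtain \<chi> where \<chi>: "character \<chi>" "\<chi> A" "\<And>B. B \<in> \<J> \<Longrightarrow> \<not> \<chi> B"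
      using exists_character[OF ideal_J, of "{A}"] A by auto
    then have x: "Stop \<chi> \<in> boundary" by (intro boundary.Stop)
    have "gact (nc_scale r (polyP A - (\<Sum>\<alpha> \<in> Delta L \<theta> A. polyS \<alpha> (\<theta> \<alpha> A) * polyT \<alpha> (\<theta> \<alpha> A))))
        (\<lambda>_. 1) (Stop \<chi>) = r"
      using \<chi> by (simp add: act_scale act_diff act_sum act_mult act_gen)
    with vanish[OF _ x] assms show ?thesis by auto
  qed
qed

end

section \<open>The graded uniqueness theorem\<close>

theorem theorem5p4:
  fixes L :: "'l set"
    and \<theta> :: "'l \<Rightarrow> 'b::generalized_boolean_algebra \<Rightarrow> 'b"
    and \<I> :: "'l \<Rightarrow> 'b set"
    and \<J> :: "'b set"
    and scale :: "'r::{comm_ring, comm_monoid_mult} \<Rightarrow> 'a::ring \<Rightarrow> 'a"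
    and gr :: "int \<Rightarrow> 'a set"
    and f :: "('b, 'l, 'r) gbds_poly set \<Rightarrow> 'a"
  assumes "relative_gbds L \<theta> \<I> \<J>"
    and "Z_graded_algebra scale gr"
    and "LR_graded_hom L \<theta> \<I> \<J> scale gr f"
  shows "inj_on f (LR_carrier L \<theta> \<I> \<J>) \<longleftrightarrow>
    (\<forall>r::'r. r \<noteq> 0 \<longrightarrow>
      (\<forall>A. A \<noteq> bot \<longrightarrow> f (LR_scale L \<theta> \<I> \<J> r (LR_p L \<theta> \<I> \<J> A)) \<noteq> 0) \<and>
      (\<forall>A \<in> regular L \<theta> - \<J>. f (LR_scale L \<theta> \<I> \<J> r (LR_q L \<theta> \<I> \<J> A)) \<noteq> 0))"
  (is "?inj \<longleftrightarrow> ?nonvanishing")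
proof
  interpret relative_gbds L \<theta> \<I> \<J> by (rule assms(1))
  show "?inj \<Longrightarrow> ?nonvanishing"
  proof -
    assume inj: ?inj
    let ?F = "free_algebra (gbds_gens L \<I>) :: ('b, 'l, 'r) gbds_poly set"
    have hom: "LR_algebra_hom L \<theta> \<I> \<J> scale f" using assms(3) by (simp add: LR_graded_hom_def)
    have f_zero: "f (LR_class L \<theta> \<I> \<J> 0) = 0"
    proof -
      have "f (LR_class L \<theta> \<I> \<J> 0) = f (LR_add L \<theta> \<I> \<J> (LR_class L \<theta> \<I> \<J> 0) (LR_class L \<theta> \<I> \<J> 0))"
        by (simp add: LR_add_class free_algebra_zero)
      also have "\<dots> = f (LR_class L \<theta> \<I> \<J> 0) + f (LR_class L \<theta> \<I> \<J> 0)"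
        using hom LR_class_mem[OF free_algebra_zero] unfolding LR_algebra_hom_def by blast
      finally show ?thesis by simp
    qed
    have nonzero: "f (LR_scale L \<theta> \<I> \<J> r (LR_class L \<theta> \<I> \<J> x)) \<noteq> 0"
      if "x \<in> ?F" "nc_scale r x \<notin> generated_ideal gens rels" for r x
    proof
      assume "f (LR_scale L \<theta> \<I> \<J> r (LR_class L \<theta> \<I> \<J> x)) = 0"
      then have "f (LR_class L \<theta> \<I> \<J> (nc_scale r x)) = f (LR_class L \<theta> \<I> \<J> 0)"
        using that by (simp add: LR_scale_class f_zero)
      then have "LR_class L \<theta> \<I> \<J> (nc_scale r x) = LR_class L \<theta> \<I> \<J> 0"
        using inj that(1) by (auto dest!: inj_onD intro!: LR_class_mem free_algebra_scale free_algebra_zero)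
      then have "(nc_scale r x, 0) \<in> LR_cong L \<theta> \<I> \<J>"
        unfolding LR_class_def using that(1)
        by (subst (asm) eq_equiv_class_iff[OF equiv_LR_cong]) (auto intro: free_algebra_scale free_algebra_zero)
      with that(2) show False by (simp add: LR_cong_def)
    qed
    show ?nonvanishing
      unfolding LR_p_def LR_q_def
    proof (intro allI impI conjI ballI)
      fix r :: 'r and A :: 'b assume "r \<noteq> 0" "A \<noteq> bot"
      then show "f (LR_scale L \<theta> \<I> \<J> r (LR_class L \<theta> \<I> \<J> (polyP A))) \<noteq> 0"
        by (intro nonzero pq_free_algebra scale_p_q_notin_ideal)
    next
      fix r :: 'r and A assume "r \<noteq> 0" "A \<in> regular L \<theta> - \<J>"
      then show "f (LR_scale L \<theta> \<I> \<J> r (LR_class L \<theta> \<I> \<J>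
          (polyP A - (\<Sum>\<alpha> \<in> Delta L \<theta> A. polyS \<alpha> (\<theta> \<alpha> A) * polyT \<alpha> (\<theta> \<alpha> A))))) \<noteq> 0"
        by (intro nonzero pq_free_algebra scale_p_q_notin_ideal) auto
    qed
  qed
  show "?nonvanishing \<Longrightarrow> ?inj"
    using assms(2,3) by (intro graded_uniqueness_if) auto
qed

end
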